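(* Let $U^n\in X_h$, $1\le n\le N$, be the solution of the fully discrete scheme: $U^0=u_h^0\in X_h$ and, for each $1\le n\le N$, $$\big(D_N^\alpha U^n,v_h\big)+a\big(l(U^n)\big)(\nabla U^n,\nabla v_h)=\big(f(U^n),v_h\big)\qquad\forall v_h\in X_h .$$ Then there is a constant $C$, independent of the mesh parameters $h$ and $N$, such that for $n=1,2,\dots,N$ $$\|U^n\|\le C\big(\|U^0\|+1\big),\qquad \|\nabla U^n\|\le C\big(\|\nabla U^0\|+1\big).$$
   Context: $\Omega\subset\mathbb{R}^{\mathsf d}$ ($\mathsf d=1$ or $2$) is a bounded open set with smooth boundary, $(\cdot,\cdot)$ and $\|\cdot\|$ are the $L^2(\Omega)$ inner product and norm, $0<\alpha<1$, $T>0$, and $l(v)=\int_\Omega v\,dx$. Hypotheses on the data: $a:\mathbb{R}\to\mathbb{R}$ satisfies $0<m_1\le a(x)\le m_2<\infty$ for all $x\in\mathbb{R}$ and is Lipschitz continuous with constant $L>0$; $f:\mathbb{R}\to\mathbb{R}$ is Lipschitz continuous with constant $K>0$; $u_0\in H_0^1(\Omega)\cap H^2(\Omega)$, and $u_h^0\in X_h$ is some approximation of $u_0$. Space discretization: $\Omega_h$ is a quasi-uniform partition of $\Omega$ into subintervals (1D) or triangles (2D) with step size $h$; $X_h=\{v\in C^0(\bar\Omega): v|_{T_k}\in P_1(T_k)\ \forall T_k\in\Omega_h,\ v=0 \text{ on }\partial\Omega\}\subset H_0^1(\Omega)$. Time discretization (L1 scheme on a graded mesh): $t_n=T(n/N)^r$,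 $n=0,\dots,N$, with mesh grading parameter $r\ge1$; $\tau_n=t_n-t_{n-1}$; for $1\le k\le n\le N$ $$d_{n,k}=\frac{(t_n-t_{n-k})^{1-\alpha}-(t_n-t_{n-k+1})^{1-\alpha}}{\tau_{n-k+1}},$$ and $$D_N^\alpha v^n=\frac{1}{\Gamma(2-\alpha)}\Big(d_{n,1}v^n-d_{n,n}v^0+\sum_{k=1}^{n-1}(d_{n,k+1}-d_{n,k})v^{n-k}\Big).$$
   Formalization: The bounds are proved under the additional time-step restriction K·Γ(2−α)·τ_N^α < 1 (τ_N is the largest step; it holds for all large N); without a restriction of this kind the claim fails, e.g. for N=1, a=1 and f(u)=Ku with K = T^{−α}/Γ(2−α)+λ_1. *)

theory Defs
  imports "HOL-Analysis.Analysis"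
begin

section \<open>Smooth domains and Sobolev spaces\<close>

text \<open>At a point where the function is not differentiable the value is unspecified. A continuous
  piecewise affine function is differentiable in the interior of each element, so its gradient is
  determined almost everywhere and is its weak gradient.\<close>
definition grad :: "('a::euclidean_space \<Rightarrow> real) \<Rightarrow> 'a \<Rightarrow> 'a" where
  "grad u x = (THE D. GDERIV u x :> D)"

primrec Ck_on :: "nat \<Rightarrow> 'a::euclidean_space set \<Rightarrow> ('a \<Rightarrow> real) \<Rightarrow> bool" where
  "Ck_on 0 S u \<longleftrightarrow> continuous_on S u"
| "Ck_on (Suc k) S u \<longleftrightarrow>
     (\<forall>x\<in>S. u differentiable (at x)) \<and> (\<forall>b\<in>Basis. Ck_on k S (\<lambda>x. grad u x \<bullet> b))"

definition smooth_on :: "'a::euclidean_space set \<Rightarrow> ('a \<Rightarrow> real) \<Rightarrow> bool" where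
  "smooth_on S u \<longleftrightarrow> (\<forall>k. Ck_on k S u)"

text \<open>Near each boundary point the domain is the sublevel set of a smooth defining function with
  nonvanishing gradient.\<close>
definition smooth_boundary :: "'a::euclidean_space set \<Rightarrow> bool" where
  "smooth_boundary \<Omega> \<longleftrightarrow>
     (\<forall>x\<in>frontier \<Omega>. \<exists>V \<phi>. open V \<and> x \<in> V \<and> smooth_on V \<phi> \<and> grad \<phi> x \<noteq> 0 \<and>
        \<Omega> \<inter> V = {y\<in>V. \<phi> y < 0})"

text \<open>Integrals are taken over the complete measure, so that values on null sets (in particular
  of \<open>grad\<close>) are irrelevant. The value type is \<open>real\<close> for functions and the
  ambient Euclidean space for gradients.\<close>
definition L2_inner ::
    "'a::euclidean_space set \<Rightarrow> ('a \<Rightarrow> 'b::real_inner) \<Rightarrow> ('a \<Rightarrow> 'b) \<Rightarrow> real" where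
  "L2_inner \<Omega> v w = (LINT x:\<Omega>|lebesgue. v x \<bullet> w x)"

definition L2_norm :: "'a::euclidean_space set \<Rightarrow> ('a \<Rightarrow> 'b::real_inner) \<Rightarrow> real" where
  "L2_norm \<Omega> v = sqrt (L2_inner \<Omega> v v)"

definition L2_fun :: "'a::euclidean_space set \<Rightarrow> ('a \<Rightarrow> 'b::euclidean_space) \<Rightarrow> bool" where
  "L2_fun \<Omega> v \<longleftrightarrow>
     set_borel_measurable lebesgue \<Omega> v \<and> set_integrable lebesgue \<Omega> (\<lambda>x. v x \<bullet> v x)"

definition test_fun :: "'a::euclidean_space set \<Rightarrow> ('a \<Rightarrow> real) \<Rightarrow> bool" where
  "test_fun \<Omega> \<phi> \<longleftrightarrow>
     smooth_on UNIV \<phi> \<and> (\<exists>S. compact S \<and> S \<subseteq> \<Omega> \<and> (\<forall>x. x \<notin> S \<longrightarrow> \<phi> x = 0))"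

definition weak_grad :: "'a::euclidean_space set \<Rightarrow> ('a \<Rightarrow> real) \<Rightarrow> ('a \<Rightarrow> 'a) \<Rightarrow> bool" where
  "weak_grad \<Omega> u g \<longleftrightarrow>
     (\<forall>\<phi>. test_fun \<Omega> \<phi> \<longrightarrow>
        (LINT x:\<Omega>|lebesgue. u x *\<^sub>R grad \<phi> x) = - (LINT x:\<Omega>|lebesgue. \<phi> x *\<^sub>R g x))"

definition H1 :: "'a::euclidean_space set \<Rightarrow> ('a \<Rightarrow> real) set" where
  "H1 \<Omega> = {u. L2_fun \<Omega> u \<and> (\<exists>g. L2_fun \<Omega> g \<and> weak_grad \<Omega> u g)}"

definition H2 :: "'a::euclidean_space set \<Rightarrow> ('a \<Rightarrow> real) set" where
  "H2 \<Omega> = {u. L2_fun \<Omega> u \<and>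
     (\<exists>g. L2_fun \<Omega> g \<and> weak_grad \<Omega> u g \<and> (\<forall>b\<in>Basis. (\<lambda>x. g x \<bullet> b) \<in> H1 \<Omega>))}"

definition H10 :: "'a::euclidean_space set \<Rightarrow> ('a \<Rightarrow> real) set" where
  "H10 \<Omega> = {u. L2_fun \<Omega> u \<and>
     (\<exists>g. L2_fun \<Omega> g \<and> weak_grad \<Omega> u g \<and>
        (\<exists>\<phi>. (\<forall>j::nat. test_fun \<Omega> (\<phi> j)) \<and>
           (\<lambda>j. L2_norm \<Omega> (\<lambda>x. \<phi> j x - u x)) \<longlonglongrightarrow> 0 \<and>
           (\<lambda>j. L2_norm \<Omega> (\<lambda>x. grad (\<phi> j) x - g x)) \<longlonglongrightarrow> 0))}"

section \<open>Finite element space\<close>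

definition mesh_size :: "'a::euclidean_space set set \<Rightarrow> real" where
  "mesh_size \<T> = Max (diameter ` \<T>)"

text \<open>A conforming partition into intervals or triangles, quasi-uniform with constant
  \<open>\<gamma>\<close>. In one dimension it covers the closure of the domain. A planar domain with smooth
  boundary is not a finite union of triangles; as usual, the triangles are then contained in the
  closed domain and may miss a boundary layer, here of width at most the mesh size.\<close>
definition fe_partition ::
    "real \<Rightarrow> 'a::euclidean_space set \<Rightarrow> 'a set set \<Rightarrow> bool" where
  "fe_partition \<gamma> \<Omega> \<T> \<longleftrightarrow>
     triangulation \<T> \<and> \<T> \<noteq> {} \<and>
     (\<forall>S\<in>\<T>. int DIM('a) simplex S \<and> S \<subseteq> closure \<Omega>) \<and>
     (DIM('a) = 1 \<longrightarrow> \<Union>\<T> = closure \<Omega>) \<and>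
     (\<forall>x\<in>\<Omega> - \<Union>\<T>. infdist x (frontier \<Omega>) \<le> mesh_size \<T>) \<and>
     (\<forall>S\<in>\<T>. \<exists>c. cball c (\<gamma> * mesh_size \<T>) \<subseteq> S)"

text \<open>Functions vanish on the boundary layer not covered by triangles, which is what makes the
  space a subspace of \<open>H10 \<Omega>\<close>. They are represented by their extension by zero outside
  the closed domain.\<close>
definition P1_space ::
    "'a::euclidean_space set \<Rightarrow> 'a set set \<Rightarrow> ('a \<Rightarrow> real) set" where
  "P1_space \<Omega> \<T> = {v. continuous_on (closure \<Omega>) v \<and>
     (\<forall>S\<in>\<T>. \<exists>b c. \<forall>x\<in>S. v x = b \<bullet> x + c) \<and>
     (\<forall>x\<in>frontier \<Omega> \<union> - \<Union>\<T>. v x = 0)}"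

section \<open>L1 scheme on a graded mesh\<close>

definition tgrid :: "real \<Rightarrow> real \<Rightarrow> nat \<Rightarrow> nat \<Rightarrow> real" where
  "tgrid T r N n = T * (real n / real N) powr r"

definition tstep :: "real \<Rightarrow> real \<Rightarrow> nat \<Rightarrow> nat \<Rightarrow> real" where
  "tstep T r N n = tgrid T r N n - tgrid T r N (n - 1)"

definition L1_weight :: "real \<Rightarrow> real \<Rightarrow> real \<Rightarrow> nat \<Rightarrow> nat \<Rightarrow> nat \<Rightarrow> real" where
  "L1_weight \<alpha> T r N n k =
     ((tgrid T r N n - tgrid T r N (n - k)) powr (1 - \<alpha>)
       - (tgrid T r N n - tgrid T r N (n - k + 1)) powr (1 - \<alpha>)) / tstep T r N (n - k + 1)"

definition L1_deriv ::
    "real \<Rightarrow> real \<Rightarrow> real \<Rightarrow> nat \<Rightarrow> (nat \<Rightarrow> 'a \<Rightarrow> real) \<Rightarrow> nat \<Rightarrow> 'a \<Rightarrow> real" where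
  "L1_deriv \<alpha> T r N v n = (\<lambda>x. 1 / Gamma (2 - \<alpha>) *
     (L1_weight \<alpha> T r N n 1 * v n x - L1_weight \<alpha> T r N n n * v 0 x
      + (\<Sum>k = 1..n - 1.
           (L1_weight \<alpha> T r N n (k + 1) - L1_weight \<alpha> T r N n k) * v (n - k) x)))"

definition fully_discrete_solution ::
    "'a::euclidean_space set \<Rightarrow> 'a set set \<Rightarrow> (real \<Rightarrow> real) \<Rightarrow> (real \<Rightarrow> real) \<Rightarrow> real \<Rightarrow> real \<Rightarrow> real
      \<Rightarrow> nat \<Rightarrow> ('a \<Rightarrow> real) \<Rightarrow> (nat \<Rightarrow> 'a \<Rightarrow> real) \<Rightarrow> bool" where
  "fully_discrete_solution \<Omega> \<T> a f \<alpha> T r N uh0 U \<longleftrightarrow>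
     U 0 = uh0 \<and>
     (\<forall>n\<in>{1..N}. U n \<in> P1_space \<Omega> \<T> \<and>
        (\<forall>v\<in>P1_space \<Omega> \<T>.
           L2_inner \<Omega> (L1_deriv \<alpha> T r N U n) v
           + a (LINT x:\<Omega>|lebesgue. U n x) * L2_inner \<Omega> (grad (U n)) (grad v)
           = L2_inner \<Omega> (\<lambda>x. f (U n x)) v))"

end

theory Submission
  imports Defs
begin

text \<open>Testing the scheme with \<open>U\<^sup>n\<close> bounds the discrete fractional derivative of the \<open>L\<^sup>2\<close> norms
  by \<open>K \<parallel>U\<^sup>n\<parallel> + F\<close>. Testing it with the discrete fractional derivative of \<open>U\<close> at step \<open>n\<close> bounds
  the discrete derivative of the squared gradient norms by the square of the same quantity.
  Both recursions are closed by a discrete fractional Gronwall inequality, which follows from a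
  comparison principle. Its supersolutions are \<open>A 2\<^sup>p\<close> with \<open>p = \<lceil>t\<^sub>j / \<delta>\<rceil>\<close> on fine meshes, where a single
  jump within distance \<open>2 \<delta>\<close> of \<open>t\<^sub>n\<close> already dominates \<open>K w + F\<close>, and \<open>A B\<^sup>j\<close> on each of the finitely
  many remaining meshes. The Poincare inequality replaces the norm of \<open>U\<^sup>0\<close> by that of its gradient.\<close>

section \<open>The L1 scheme on the graded mesh\<close>

text \<open>The obstacle is uniformity in N. The restriction
  \<open>K * Gamma (2 - \<alpha>) * tstep T r N N powr \<alpha> < 1\<close> says that the diagonal
  coefficient of the last step exceeds K; as the steps of the graded mesh increase, this holds at
  every level and makes the implicit recursion monotone. A supersolution growing by a fixed factor
  per step yields a bound exponential in N. The L1 operator, however, remembers the past: on an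
  increasing sequence it is at least any jump \<open>w n - w m\<close> times a weight that is
  bounded below in terms of the time distance alone. Growth can therefore be counted per unit of
  time instead of per step. This needs steps no longer than \<delta>, so that some grid point lies
  just before the current \<delta>-interval. Since the longest step tends to 0, only finitely many N
  are left over, and for them a dependence on N and on the margin in the restriction is
  harmless.\<close>

definition L1_coeff :: "real \<Rightarrow> real \<Rightarrow> real \<Rightarrow> nat \<Rightarrow> nat \<Rightarrow> nat \<Rightarrow> real" where
  "L1_coeff \<alpha> T r N n j =
     (if j = n then L1_weight \<alpha> T r N n 1
      else if j = 0 then - L1_weight \<alpha> T r N n n
      else L1_weight \<alpha> T r N n (n - j + 1) - L1_weight \<alpha> T r N n (n - j)) / Gamma (2 - \<alpha>)"

text \<open>Substituting j = n - k indexes the history by time level. The scheme becomes a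
  triangular system whose coefficient signs and row sums drive all later estimates.\<close>

lemma L1_deriv_eq_sum:
  assumes "1 \<le> n"
  shows "L1_deriv \<alpha> T r N v n x = (\<Sum>j\<le>n. L1_coeff \<alpha> T r N n j * v j x)"
proof -
  let ?d = "L1_weight \<alpha> T r N n"
  have "(\<Sum>j\<le>n. L1_coeff \<alpha> T r N n j * v j x)
      = L1_coeff \<alpha> T r N n n * v n x + L1_coeff \<alpha> T r N n 0 * v 0 x
        + (\<Sum>j=1..n-1. L1_coeff \<alpha> T r N n j * v j x)"
  proof -
    have "{..n} = insert n (insert 0 {1..n-1})" using assms by auto
    then show ?thesis using assms by (simp add: add.assoc)
  qed
  also have "(\<Sum>j=1..n-1. L1_coeff \<alpha> T r N n j * v j x)
      = (\<Sum>k=1..n-1. 1 / Gamma (2 - \<alpha>) * ((?d (k + 1) - ?d k) * v (n - k) x))"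
    by (rule sum.reindex_bij_witness[of _ "\<lambda>k. n - k" "\<lambda>j. n - j"])
       (auto simp: L1_coeff_def)
  finally show ?thesis
    using assms unfolding L1_deriv_def sum_distrib_left[symmetric]
    by (simp add: L1_coeff_def algebra_simps add_divide_distrib diff_divide_distrib)
qed

text \<open>The differences telescope, so the whole history up to m carries a single L1 weight. This
  is what later turns a jump of a sequence into one weight.\<close>

lemma sum_L1_coeff:
  assumes "m < n"
  shows "(\<Sum>j\<le>m. - L1_coeff \<alpha> T r N n j) = L1_weight \<alpha> T r N n (n - m) / Gamma (2 - \<alpha>)"
  using assms
proof (induction m)
  case 0
  then show ?case by (simp add: L1_coeff_def)
next
  case (Suc m)
  have "n - m = n - Suc m + 1" using Suc.prems by simp
  with Suc show ?case by (simp add: L1_coeff_def diff_divide_distrib)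
qed

text \<open>The scheme differentiates constants to zero, because the diagonal weight balances the
  total weight of the history. Sums can thus be rewritten in the differences
  \<open>w n - w j\<close>.\<close>

lemma sum_L1_coeff_eq_0:
  assumes "1 \<le> n"
  shows "(\<Sum>j\<le>n. L1_coeff \<alpha> T r N n j) = 0"
proof -
  obtain m where m: "n = Suc m" using assms by (cases n) auto
  show ?thesis using sum_L1_coeff[of m n \<alpha> T r N]
    by (simp add: m L1_coeff_def sum_negf)
qed

section \<open>Graded time grid and monotonicity of the L1 weights\<close>

lemma tgrid_0 [simp]: "tgrid T r N 0 = 0"
  by (simp add: tgrid_def)

lemma tgrid_less:
  assumes "0 < T" "0 < r" "1 \<le> N" "m < n"
  shows "tgrid T r N m < tgrid T r N n"
  using assms by (auto simp: tgrid_def intro!: powr_less_mono2 divide_strict_right_mono)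

lemma tgrid_mono:
  assumes "0 < T" "0 < r" "1 \<le> N" "m \<le> n"
  shows "tgrid T r N m \<le> tgrid T r N n"
  using assms tgrid_less[of T r N m n] by (cases "m = n") auto

lemma tgrid_last: "1 \<le> N \<Longrightarrow> tgrid T r N N = T"
  by (simp add: tgrid_def)

lemma tstep_pos:
  assumes "0 < T" "0 < r" "1 \<le> N" "1 \<le> n"
  shows "0 < tstep T r N n"
  using tgrid_less[of T r N "n - 1" n] assms by (simp add: tstep_def)

text \<open>Mean value theorem for a power. The left end may be 0, where the derivative can be
  singular; this occurs for the newest time cell and for the first grid step.\<close>

lemma powr_secant:
  fixes p x y :: real
  assumes "0 < p" "0 \<le> x" "x < y"
  obtains z where "x < z" "z < y" "y powr p - x powr p = (y - x) * (p * z powr (p - 1))"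
proof -
  have "\<exists>z. x < z \<and> z < y \<and> y powr p - x powr p = (p * z powr (p - 1)) * (y - x)"
  proof (rule mvt[OF \<open>x < y\<close>, of "\<lambda>t. t powr p" "\<lambda>z h. (p * z powr (p - 1)) * h", simplified, unfolded bex_simps])
    show "continuous_on {x..y} (\<lambda>t. t powr p)"
      using assms by (intro continuous_on_powr') (auto intro!: continuous_intros)
  next
    fix z assume "x < z" "z < y"
    then have "((\<lambda>t. t powr p) has_real_derivative p * z powr (p - 1)) (at z)"
      using assms by (intro DERIV_powr[THEN DERIV_cong] derivative_eq_intros) (auto simp: field_simps)
    then show "((\<lambda>t. t powr p) has_derivative (\<lambda>h. (p * z powr (p - 1)) * h)) (at z)"
      by (simp add: has_field_derivative_def)
  qed auto
  then show ?thesis using that by (auto simp: mult.commute)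
qed

text \<open>A weight is the mean of (1 - \<alpha>) s^(-\<alpha>) over one time cell, s being the
  distance back from t_n. Naming an intermediate point reduces monotonicity and lower bounds to the
  decay of this kernel.\<close>

lemma L1_weight_mvt:
  assumes "0 < \<alpha>" "\<alpha> < 1" "0 < T" "0 < r" "1 \<le> N" "1 \<le> k" "k \<le> n"
  obtains z where "tgrid T r N n - tgrid T r N (n - k + 1) < z"
    "z < tgrid T r N n - tgrid T r N (n - k)"
    "L1_weight \<alpha> T r N n k = (1 - \<alpha>) * z powr (- \<alpha>)"
proof -
  have mono: "tgrid T r N (n - k + 1) \<le> tgrid T r N n"
    using assms by (intro tgrid_mono) auto
  have less: "tgrid T r N (n - k) < tgrid T r N (n - k + 1)"
    using assms by (intro tgrid_less) auto
  obtain z where z: "tgrid T r N n - tgrid T r N (n - k + 1) < z"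
    "z < tgrid T r N n - tgrid T r N (n - k)"
    "(tgrid T r N n - tgrid T r N (n - k)) powr (1 - \<alpha>)
       - (tgrid T r N n - tgrid T r N (n - k + 1)) powr (1 - \<alpha>)
     = (tgrid T r N (n - k + 1) - tgrid T r N (n - k)) * ((1 - \<alpha>) * z powr (- \<alpha>))"
    by (rule powr_secant[of "1 - \<alpha>" "tgrid T r N n - tgrid T r N (n - k + 1)"
          "tgrid T r N n - tgrid T r N (n - k)"]) (use assms mono less in auto)
  show ?thesis
    using z(3) less by (intro that[OF z(1,2)]) (simp add: L1_weight_def tstep_def)
qed

lemma L1_weight_antimono:
  assumes "0 < \<alpha>" "\<alpha> < 1" "0 < T" "0 < r" "1 \<le> N" "1 \<le> k" "k + 1 \<le> n"
  shows "L1_weight \<alpha> T r N n (k + 1) \<le> L1_weight \<alpha> T r N n k"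
proof -
  obtain z where z: "tgrid T r N n - tgrid T r N (n - k + 1) < z"
    "z < tgrid T r N n - tgrid T r N (n - k)"
    "L1_weight \<alpha> T r N n k = (1 - \<alpha>) * z powr (- \<alpha>)"
    by (rule L1_weight_mvt[of \<alpha> T r N k n]) (use assms in auto)
  obtain z' where z': "tgrid T r N n - tgrid T r N (n - (k + 1) + 1) < z'"
    "L1_weight \<alpha> T r N n (k + 1) = (1 - \<alpha>) * z' powr (- \<alpha>)"
    by (rule L1_weight_mvt[of \<alpha> T r N "k + 1" n]) (use assms in auto)
  \<comment> \<open>The two cells are adjacent: the upper end for k is the lower end for k + 1,
    which orders the intermediate points.\<close>
  have "n - (k + 1) + 1 = n - k" using assms by simp
  then have "z < z'" using z z' by simp
  moreover have "0 < z"
    using z(1) tgrid_mono[of T r N "n - k + 1" n] assms by fastforce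
  ultimately show ?thesis
    using assms z z' by (auto intro!: mult_left_mono powr_mono2')
qed

text \<open>The kernel is smallest at the far end of the cell. The bound sees only the time
  distance, not the number of grid points in between.\<close>

lemma L1_weight_ge:
  assumes "0 < \<alpha>" "\<alpha> < 1" "0 < T" "0 < r" "1 \<le> N" "m < n"
  shows "(1 - \<alpha>) * (tgrid T r N n - tgrid T r N m) powr (- \<alpha>) \<le> L1_weight \<alpha> T r N n (n - m)"
proof -
  obtain z where z: "tgrid T r N n - tgrid T r N (n - (n - m) + 1) < z"
    "z < tgrid T r N n - tgrid T r N (n - (n - m))"
    "L1_weight \<alpha> T r N n (n - m) = (1 - \<alpha>) * z powr (- \<alpha>)"
    by (rule L1_weight_mvt[of \<alpha> T r N "n - m" n]) (use assms in auto)
  have "0 < z"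
    using z(1) tgrid_mono[of T r N "m + 1" n] assms by auto
  then show ?thesis
    using assms z by (auto intro!: mult_left_mono powr_mono2')
qed

lemma L1_weight_pos:
  assumes "0 < \<alpha>" "\<alpha> < 1" "0 < T" "0 < r" "1 \<le> N" "m < n"
  shows "0 < L1_weight \<alpha> T r N n (n - m)"
  using L1_weight_ge[OF assms] tgrid_less[of T r N m n] assms
  by (smt (verit, best) mult_pos_pos powr_gt_zero)

text \<open>On the newest cell the second power is 0 powr (1 - \<alpha>) = 0, so the quotient
  collapses.\<close>

lemma L1_weight_1:
  assumes "0 < T" "0 < r" "1 \<le> N" "1 \<le> n"
  shows "L1_weight \<alpha> T r N n 1 = tstep T r N n powr (- \<alpha>)"
proof -
  have "n - 1 + 1 = n" using assms by simp
  then have "L1_weight \<alpha> T r N n 1 = tstep T r N n powr (1 - \<alpha>) / tstep T r N n"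
    by (simp add: L1_weight_def tstep_def)
  also have "\<dots> = tstep T r N n powr (1 - \<alpha> - 1)"
    using tstep_pos[OF assms] powr_diff[of "tstep T r N n" "1 - \<alpha>" 1] by simp
  finally show ?thesis by simp
qed

text \<open>Convexity of t^r for r \<ge> 1: the secant slopes, written as derivatives at
  intermediate points, increase from cell to cell.\<close>

lemma tstep_le_Suc:
  assumes "0 < T" "1 \<le> r" "1 \<le> N" "1 \<le> n"
  shows "tstep T r N n \<le> tstep T r N (Suc n)"
proof -
  obtain y where y: "real (n - 1) / N < y" "y < real n / N"
    "(real n / N) powr r - (real (n - 1) / N) powr r
      = (real n / N - real (n - 1) / N) * (r * y powr (r - 1))"
    by (rule powr_secant[of r "real (n - 1) / N" "real n / N"])
       (use assms in \<open>auto simp: divide_strict_right_mono\<close>)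
  obtain z where z: "real n / N < z"
    "(real (Suc n) / N) powr r - (real n / N) powr r
      = (real (Suc n) / N - real n / N) * (r * z powr (r - 1))"
    by (rule powr_secant[of r "real n / N" "real (Suc n) / N"])
       (use assms in \<open>auto simp: divide_strict_right_mono\<close>)
  have diffs: "real n / N - real (n - 1) / N = 1 / N" "real (Suc n) / N - real n / N = 1 / N"
    using assms by (auto simp: of_nat_diff field_simps)
  have "0 \<le> real (n - 1) / N" by simp
  also have "\<dots> < y" by (rule y)
  finally have "y powr (r - 1) \<le> z powr (r - 1)"
    using y z assms by (intro powr_mono2) auto
  then have "(real n / N) powr r - (real (n - 1) / N) powr r
      \<le> (real (Suc n) / N) powr r - (real n / N) powr r"
    unfolding y z diffs using assms by (intro mult_left_mono) auto
  then have "T * ((real n / N) powr r - (real (n - 1) / N) powr r)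
      \<le> T * ((real (Suc n) / N) powr r - (real n / N) powr r)"
    using assms by (intro mult_left_mono) auto
  then show ?thesis
    by (simp add: tstep_def tgrid_def right_diff_distrib)
qed

lemma tstep_le_last:
  assumes "0 < T" "1 \<le> r" "1 \<le> n" "n \<le> N"
  shows "tstep T r N n \<le> tstep T r N N"
  using \<open>n \<le> N\<close>
proof (induction rule: inc_induct)
  case (step k)
  then show ?case using tstep_le_Suc[of T r N k] assms by simp
qed simp

lemma tstep_last_tendsto_0: "(\<lambda>N. tstep T r N N) \<longlonglongrightarrow> 0"
proof -
  \<comment> \<open>The quotient N / N is kept so that the term matches the grid point N - 1; it
    equals 1 except at N = 0.\<close>
  have "(\<lambda>N. real N / real N - 1 / real N) \<longlonglongrightarrow> 1 - 0"
    by (intro tendsto_diff lim_1_over_n tendsto_eventually)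
       (auto simp: eventually_sequentially intro!: exI[of _ 1])
  then have lim: "(\<lambda>N. (real N / real N - 1 / real N) powr r) \<longlonglongrightarrow> 1 powr r"
    by (intro tendsto_powr) auto
  have "(\<lambda>N. T * 1 - T * (real N / real N - 1 / real N) powr r) \<longlonglongrightarrow> T * 1 - T * 1 powr r"
    by (intro tendsto_diff tendsto_mult tendsto_const lim)
  moreover have "\<forall>\<^sub>F N in sequentially. T * 1 - T * (real N / real N - 1 / real N) powr r = tstep T r N N"
    using eventually_ge_at_top[of 1]
    by eventually_elim (simp add: tstep_def tgrid_def of_nat_diff diff_divide_distrib)
  ultimately show ?thesis by (simp add: Lim_transform_eventually)
qed

section \<open>Sign structure, comparison principle and fractional Gronwall inequality\<close>

lemma L1_coeff_nonpos:
  assumes "0 < \<alpha>" "\<alpha> < 1" "0 < T" "0 < r" "1 \<le> N" "j < n"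
  shows "L1_coeff \<alpha> T r N n j \<le> 0"
proof -
  have G: "0 < Gamma (2 - \<alpha>)" using assms by (intro Gamma_real_pos) auto
  show ?thesis
  proof (cases "j = 0")
    case True
    then show ?thesis
      using L1_weight_pos[of \<alpha> T r N 0 n] assms G by (simp add: L1_coeff_def)
  next
    case False
    then show ?thesis
      using L1_weight_antimono[of \<alpha> T r N "n - j" n] assms G
      by (simp add: L1_coeff_def divide_le_0_iff)
  qed
qed

lemma L1_coeff_diag:
  assumes "0 < T" "0 < r" "1 \<le> N" "1 \<le> n"
  shows "L1_coeff \<alpha> T r N n n = tstep T r N n powr (- \<alpha>) / Gamma (2 - \<alpha>)"
  using L1_weight_1[OF assms] by (simp add: L1_coeff_def)

text \<open>By the zero row sum the operator is a sum of nonnegative terms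
  \<open>- ?c j * (w n - w j)\<close>. Keeping those with j \<le> m and enlarging \<open>w j\<close>
  to \<open>w m\<close> leaves one telescoped weight, so a single jump bounds the nonlocal operator
  from below.\<close>

lemma sum_L1_coeff_ge_jump:
  assumes "0 < \<alpha>" "\<alpha> < 1" "0 < T" "0 < r" "1 \<le> N" "m < n"
    and mono: "\<And>j. j \<le> m \<Longrightarrow> w j \<le> w m" "\<And>j. j \<le> n \<Longrightarrow> w j \<le> w n"
  shows "L1_weight \<alpha> T r N n (n - m) / Gamma (2 - \<alpha>) * (w n - w m)
       \<le> (\<Sum>j\<le>n. L1_coeff \<alpha> T r N n j * w j)"
proof -
  let ?c = "L1_coeff \<alpha> T r N n"
  have nonneg: "0 \<le> - ?c j" if "j < n" for j
    using L1_coeff_nonpos[of \<alpha> T r N j n] assms that by simp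
  have "L1_weight \<alpha> T r N n (n - m) / Gamma (2 - \<alpha>) * (w n - w m)
      = (\<Sum>j\<le>m. - ?c j * (w n - w m))"
    using sum_L1_coeff[OF \<open>m < n\<close>, of \<alpha> T r N] unfolding sum_distrib_right[symmetric] by simp
  also have "\<dots> \<le> (\<Sum>j\<le>m. - ?c j * (w n - w j))"
    using assms nonneg by (intro sum_mono mult_left_mono) auto
  also have "\<dots> \<le> (\<Sum>j\<le>n. - ?c j * (w n - w j))"
  proof (rule sum_mono2)
    \<comment> \<open>The coefficient at j = n has the other sign, but its difference
      vanishes.\<close>
    fix j assume "j \<in> {..n} - {..m}"
    then show "0 \<le> - ?c j * (w n - w j)"
      using nonneg[of j] mono(2)[of j]
      by (cases "j = n") (auto simp: mult_nonpos_nonneg)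
  qed (use assms in auto)
  also have "\<dots> = (\<Sum>j\<le>n. ?c j * w j) - (\<Sum>j\<le>n. ?c j) * w n"
    by (simp add: algebra_simps sum_subtractf sum_distrib_left sum_distrib_right)
  finally show ?thesis
    using sum_L1_coeff_eq_0[of n \<alpha> T r N] assms by simp
qed

text \<open>Induction over the time levels. Since the history coefficients are nonpositive, the
  order of the earlier values makes the history sum of v at least that of w. What remains is the
  order of \<open>v n\<close> and \<open>w n\<close> multiplied by the positive factor
  \<open>?c n - K\<close>.\<close>

lemma L1_comparison:
  assumes "0 < \<alpha>" "\<alpha> < 1" "0 < T" "1 \<le> r" "1 \<le> N"
    and small: "K * Gamma (2 - \<alpha>) * tstep T r N N powr \<alpha> < 1"
    and sub: "\<And>n. n \<in> {1..N} \<Longrightarrow> (\<Sum>j\<le>n. L1_coeff \<alpha> T r N n j * v j) \<le> K * v n + F"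
    and super: "\<And>n. n \<in> {1..N} \<Longrightarrow> K * w n + F \<le> (\<Sum>j\<le>n. L1_coeff \<alpha> T r N n j * w j)"
    and init: "v 0 \<le> w 0"
    and "n \<le> N"
  shows "v n \<le> w n"
  using \<open>n \<le> N\<close>
proof (induction n rule: less_induct)
  case (less n)
  show ?case
  proof (cases "n = 0")
    case False
    let ?c = "L1_coeff \<alpha> T r N n"
    have G: "0 < Gamma (2 - \<alpha>)" using assms by (intro Gamma_real_pos) auto
    have n: "1 \<le> n" "n \<le> N" using False less.prems by auto
    \<comment> \<open>The restriction concerns the longest step, hence the smallest diagonal
      coefficient, and so covers all levels.\<close>
    have "K < tstep T r N N powr (- \<alpha>) / Gamma (2 - \<alpha>)"
      using small G tstep_pos[of T r N N] assms by (simp add: powr_minus field_simps)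
    also have "\<dots> \<le> tstep T r N n powr (- \<alpha>) / Gamma (2 - \<alpha>)"
      using tstep_le_last[of T r n N] tstep_pos[of T r N n] assms n G
      by (intro divide_right_mono powr_mono2') auto
    also have "\<dots> = ?c n" using assms n by (simp add: L1_coeff_diag)
    finally have K: "K < ?c n" .
    have split: "(\<Sum>j\<le>n. ?c j * u j) = ?c n * u n + (\<Sum>j<n. ?c j * u j)" for u
      by (simp add: lessThan_Suc_atMost[symmetric])
    have "(\<Sum>j\<le>n. ?c j * v j) - K * v n \<le> (\<Sum>j\<le>n. ?c j * w j) - K * w n"
      using sub[of n] super[of n] n by auto
    moreover have "(\<Sum>j<n. ?c j * w j) \<le> (\<Sum>j<n. ?c j * v j)"
      using less.IH less.prems L1_coeff_nonpos[of \<alpha> T r N _ n] assms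
      by (intro sum_mono mult_left_mono_neg) auto
    ultimately have "(?c n - K) * v n \<le> (?c n - K) * w n"
      unfolding split by (simp add: algebra_simps)
    then show ?thesis using K by simp
  qed (use init in simp)
qed

text \<open>Phrased as a property of C on one mesh, so that constants found mesh by mesh can be
  enlarged and merged. C has to serve all sequences v and forcings F at once.\<close>

definition L1_gronwall_const :: "real \<Rightarrow> real \<Rightarrow> real \<Rightarrow> real \<Rightarrow> nat \<Rightarrow> real \<Rightarrow> bool" where
  "L1_gronwall_const \<alpha> T r K N C \<longleftrightarrow> (\<forall>v F. 0 \<le> v 0 \<longrightarrow> 0 \<le> F \<longrightarrow>
    (\<forall>n\<in>{1..N}. (\<Sum>j\<le>n. L1_coeff \<alpha> T r N n j * v j) \<le> K * v n + F) \<longrightarrow>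
    (\<forall>n\<le>N. v n \<le> C * (v 0 + F)))"

lemma L1_gronwall_const_mono:
  assumes "L1_gronwall_const \<alpha> T r K N C" "C \<le> C'"
  shows "L1_gronwall_const \<alpha> T r K N C'"
  unfolding L1_gronwall_const_def
proof (intro allI impI)
  fix v :: "nat \<Rightarrow> real" and F n
  assume v: "0 \<le> v 0" "0 \<le> F" and n: "n \<le> N"
    and sub: "\<forall>n\<in>{1..N}. (\<Sum>j\<le>n. L1_coeff \<alpha> T r N n j * v j) \<le> K * v n + F"
  have "v n \<le> C * (v 0 + F)"
    using assms(1) v sub n unfolding L1_gronwall_const_def by simp
  also have "\<dots> \<le> C' * (v 0 + F)" using assms v by (intro mult_right_mono) auto
  finally show "v n \<le> C' * (v 0 + F)" .
qed

text \<open>A geometric sequence of ratio B has last jump (1 - 1 / B) \<open>w n\<close>; for large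
  B this times the diagonal coefficient dominates \<open>K * w n + F\<close>. The resulting constant
  depends on N and degenerates as c approaches K.\<close>

lemma L1_gronwall_fixed_mesh:
  assumes "0 < \<alpha>" "\<alpha> < 1" "0 < T" "1 \<le> r" "1 \<le> N" "0 \<le> K"
    and small: "K * Gamma (2 - \<alpha>) * tstep T r N N powr \<alpha> < 1"
  shows "\<exists>C\<ge>0. L1_gronwall_const \<alpha> T r K N C"
proof -
  define c where "c = tstep T r N N powr (- \<alpha>) / Gamma (2 - \<alpha>)"
  have G: "0 < Gamma (2 - \<alpha>)" using assms by (intro Gamma_real_pos) auto
  have cK: "K < c"
    unfolding c_def using small G tstep_pos[of T r N N] assms by (simp add: powr_minus field_simps)
  \<comment> \<open>Half of the margin pays for F. The ratio is then forced: (K + e) B = c (B - 1)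
    together with c - K - e = e gives B = c / e.\<close>
  define e where "e = (c - K) / 2"
  have e: "0 < e" "e \<le> c" using cK \<open>0 \<le> K\<close> by (auto simp: e_def)
  have "2 * e = c - K" by (simp add: e_def)
  then have Ke: "K + e = c - e" by linarith
  define B where "B = c / e"
  \<comment> \<open>Makes A = D (v 0 + F) at least v 0 and A e at least F.\<close>
  define D where "D = 1 + 1 / e"
  have B: "1 \<le> B" using e by (simp add: B_def)
  have D: "1 \<le> D" using e by (simp add: D_def)
  have D': "1 \<le> D * e" using e by (simp add: D_def distrib_right)
  have cB: "(K + e) * B = c * (B - 1)"
    unfolding Ke B_def using e by (simp add: left_diff_distrib right_diff_distrib diff_divide_distrib)
  have "v n \<le> (D * B ^ N) * (v 0 + F)"
    if v0: "0 \<le> v 0" and F: "0 \<le> F" and n: "n \<le> N"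
      and sub: "\<forall>n\<in>{1..N}. (\<Sum>j\<le>n. L1_coeff \<alpha> T r N n j * v j) \<le> K * v n + F"
    for v F n
  proof -
    define A where "A = D * (v 0 + F)"
    have A: "0 \<le> A" "v 0 \<le> A" "F \<le> A * e"
    proof -
      show "0 \<le> A" using D v0 F by (simp add: A_def)
      show "v 0 \<le> A"
        using mult_right_mono[OF D, of "v 0 + F"] v0 F by (simp add: A_def)
      show "F \<le> A * e"
        using mult_right_mono[OF D', of "v 0 + F"] v0 F by (simp add: A_def mult_ac)
    qed
    define w where "w j = A * B ^ j" for j
    have mono: "w i \<le> w j" if "i \<le> j" for i j
      using that A B by (auto simp: w_def intro!: mult_left_mono power_increasing)
    have "v n \<le> w n"
    proof (rule L1_comparison[OF assms(1-5) small])
      fix n assume n: "n \<in> {1..N}"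
      then obtain m where m: "n = Suc m" by (cases n) auto
      have "K * w n + F \<le> K * w n + e * w n"
      proof -
        have "0 \<le> A * e" using A e by simp
        then have "A * e * 1 \<le> A * e * B ^ n"
          using B by (intro mult_left_mono one_le_power) auto
        then show ?thesis using A(3) by (simp add: w_def mult_ac)
      qed
      also have "\<dots> = A * B ^ m * ((K + e) * B)"
        by (simp add: w_def m distrib_right distrib_left mult_ac)
      also have "\<dots> = c * (w n - w m)"
        unfolding cB by (simp add: w_def m right_diff_distrib mult_ac)
      \<comment> \<open>The jump starts at the preceding level, so its weight is the diagonal one,
        which is smallest at the last step.\<close>
      also have "\<dots> \<le> L1_weight \<alpha> T r N n (n - m) / Gamma (2 - \<alpha>) * (w n - w m)"
      proof (rule mult_right_mono)
        have "tstep T r N N powr (- \<alpha>) \<le> tstep T r N n powr (- \<alpha>)"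
          using tstep_le_last[of T r n N] tstep_pos[of T r N n] assms n
          by (intro powr_mono2') auto
        then show "c \<le> L1_weight \<alpha> T r N n (n - m) / Gamma (2 - \<alpha>)"
          using L1_weight_1[of T r N n \<alpha>] assms n G
          by (simp add: c_def m divide_right_mono)
      qed (use mono[of m n] m in simp)
      also have "\<dots> \<le> (\<Sum>j\<le>n. L1_coeff \<alpha> T r N n j * w j)"
        using assms m mono by (intro sum_L1_coeff_ge_jump) auto
      finally show "K * w n + F \<le> (\<Sum>j\<le>n. L1_coeff \<alpha> T r N n j * w j)" .
    qed (use sub A n in \<open>auto simp: w_def\<close>)
    also have "\<dots> \<le> w N" using n by (rule mono)
    finally show ?thesis by (simp add: w_def A_def mult_ac)
  qed
  then have "L1_gronwall_const \<alpha> T r K N (D * B ^ N)"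
    unfolding L1_gronwall_const_def by simp
  moreover have "0 \<le> D * B ^ N" using D B by simp
  ultimately show ?thesis by blast
qed

text \<open>For a suitable \<delta> depending on \<alpha> and K only, jumps over a time distance of
  at most 2 \<delta> carry a weight of at least 2 (K + 1). A sequence doubling once per interval of
  length \<delta> is then a supersolution, and the number of doublings up to time T does not depend
  on the mesh.\<close>

lemma L1_gronwall_fine_mesh:
  assumes "0 < \<alpha>" "\<alpha> < 1" "0 < T" "1 \<le> r" "0 \<le> K"
  obtains C \<delta> where "0 \<le> C" "0 < \<delta>"
    "\<And>N. 1 \<le> N \<Longrightarrow> tstep T r N N \<le> \<delta> \<Longrightarrow>
      K * Gamma (2 - \<alpha>) * tstep T r N N powr \<alpha> < 1 \<Longrightarrow> L1_gronwall_const \<alpha> T r K N C"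
proof -
  have G: "0 < Gamma (2 - \<alpha>)" using assms by (intro Gamma_real_pos) auto
  \<comment> \<open>Chosen so that the kernel bound at distance 2 \<delta> equals 2 (K + 1). The
    factor 2 compensates for a jump of only half of \<open>w n\<close>; K + 1 covers
    \<open>K * w n\<close> and F together.\<close>
  define q where "q = 2 * (K + 1) * Gamma (2 - \<alpha>) / (1 - \<alpha>)"
  have q: "0 < q" using assms G by (simp add: q_def)
  define \<delta> where "\<delta> = q powr (- 1 / \<alpha>) / 2"
  have \<delta>: "0 < \<delta>" using q by (simp add: \<delta>_def)
  have \<delta>q: "(1 - \<alpha>) * (2 * \<delta>) powr (- \<alpha>) / Gamma (2 - \<alpha>) = 2 * (K + 1)"
    using q assms less_imp_neq[OF G] by (simp add: \<delta>_def powr_powr q_def)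
  have "v n \<le> 2 ^ nat \<lceil>T / \<delta>\<rceil> * (v 0 + F)"
    if N: "1 \<le> N" and step: "tstep T r N N \<le> \<delta>"
      and small: "K * Gamma (2 - \<alpha>) * tstep T r N N powr \<alpha> < 1"
      and v0: "0 \<le> v 0" and F: "0 \<le> F" and n: "n \<le> N"
      and sub: "\<forall>n\<in>{1..N}. (\<Sum>j\<le>n. L1_coeff \<alpha> T r N n j * v j) \<le> K * v n + F"
    for N v F n
  proof -
    define A where "A = v 0 + F"
    define p where "p j = nat \<lceil>tgrid T r N j / \<delta>\<rceil>" for j
    define w where "w j = A * 2 ^ p j" for j
    have A: "0 \<le> A" using v0 F by (simp add: A_def)
    have pmono: "p i \<le> p j" if "i \<le> j" for i j
      using tgrid_mono[of T r N i j] that assms N \<delta>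
      unfolding p_def by (intro nat_mono ceiling_mono divide_right_mono) auto
    have mono: "w i \<le> w j" if "i \<le> j" for i j
      using pmono[OF that] A by (auto simp: w_def intro!: mult_left_mono power_increasing)
    have "v n \<le> w n"
    proof (rule L1_comparison[OF assms(1-4) N small])
      fix n assume n: "n \<in> {1..N}"
      have tn: "0 < tgrid T r N n" using tgrid_less[of T r N 0 n] assms n N by simp
      have pn: "1 \<le> p n" "tgrid T r N n \<le> real (p n) * \<delta>" "(real (p n) - 1) * \<delta> < tgrid T r N n"
      proof -
        have pos: "0 < tgrid T r N n / \<delta>" using tn \<delta> by simp
        then have "0 < \<lceil>tgrid T r N n / \<delta>\<rceil>" by simp
        then show "1 \<le> p n" unfolding p_def by linarith
        have eq: "real (p n) = of_int \<lceil>tgrid T r N n / \<delta>\<rceil>"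
          using \<open>0 < \<lceil>tgrid T r N n / \<delta>\<rceil>\<close> by (simp add: p_def)
        show "tgrid T r N n \<le> real (p n) * \<delta>"
          using le_of_int_ceiling[of "tgrid T r N n / \<delta>"] \<delta> unfolding eq by (simp only: pos_divide_le_eq)
        show "(real (p n) - 1) * \<delta> < tgrid T r N n"
          using ceiling_correct[of "tgrid T r N n / \<delta>"] \<delta> unfolding eq by (simp add: field_simps)
      qed
      \<comment> \<open>The last grid point not beyond the start of the \<delta>-interval containing
        t_n. Its successor lies beyond that start and steps are at most \<delta>, so t_m is at most
        2 \<delta> back, yet belongs to an earlier interval.\<close>
      define m where "m = (GREATEST j. j \<le> n \<and> tgrid T r N j \<le> (real (p n) - 1) * \<delta>)"
      let ?P = "\<lambda>j. j \<le> n \<and> tgrid T r N j \<le> (real (p n) - 1) * \<delta>"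
      have P0: "?P 0" using pn \<delta> by simp
      have Pm: "?P m" unfolding m_def by (rule GreatestI_nat[of ?P 0 n]) (use P0 in auto)
      have max: "j \<le> m" if "?P j" for j
        unfolding m_def by (rule Greatest_le_nat[of ?P j n]) (use that in auto)
      have mn: "m < n" using Pm pn(3) by (metis le_neq_implies_less not_less)
      have "(real (p n) - 1) * \<delta> < tgrid T r N (Suc m)"
        using max[of "Suc m"] mn by (meson Suc_leI not_less not_less_eq_eq order_refl)
      moreover have "tgrid T r N (Suc m) - tgrid T r N m \<le> \<delta>"
        using tstep_le_last[of T r "Suc m" N] step assms mn n by (simp add: tstep_def)
      ultimately have close: "tgrid T r N n - tgrid T r N m \<le> 2 * \<delta>"
        using pn(2) by (simp add: algebra_simps)
      have "p m \<le> p n - 1"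
      proof -
        have "tgrid T r N m / \<delta> \<le> of_int (int (p n) - 1)"
          using Pm \<delta> by (simp add: field_simps)
        then have "\<lceil>tgrid T r N m / \<delta>\<rceil> \<le> int (p n) - 1" by (simp only: ceiling_le_iff)
        then show ?thesis using pn(1) unfolding p_def[of m] by linarith
      qed
      then have "w m \<le> A * 2 ^ (p n - 1)"
        using A by (auto simp: w_def intro!: mult_left_mono power_increasing)
      also have "\<dots> = w n / 2"
        using pn(1) by (cases "p n") (auto simp: w_def)
      finally have jump: "w n / 2 \<le> w n - w m" by simp
      \<comment> \<open>The sequence never falls below A = v 0 + F, which is how it absorbs the
        forcing.\<close>
      have "A * 1 \<le> w n" unfolding w_def using A by (intro mult_left_mono) auto
      then have wn: "F \<le> w n" "0 \<le> w n" using v0 A by (auto simp: A_def)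
      have "K * w n + F \<le> 2 * (K + 1) * (w n / 2)"
        using wn by (simp add: algebra_simps)
      also have "\<dots> \<le> 2 * (K + 1) * (w n - w m)"
        using jump assms by (intro mult_left_mono) auto
      also have "\<dots> \<le> L1_weight \<alpha> T r N n (n - m) / Gamma (2 - \<alpha>) * (w n - w m)"
      proof (rule mult_right_mono)
        have "(1 - \<alpha>) * (2 * \<delta>) powr (- \<alpha>) \<le> (1 - \<alpha>) * (tgrid T r N n - tgrid T r N m) powr (- \<alpha>)"
          using close tgrid_less[of T r N m n] assms N mn
          by (intro mult_left_mono powr_mono2') auto
        also have "\<dots> \<le> L1_weight \<alpha> T r N n (n - m)"
          using assms N mn by (intro L1_weight_ge) auto
        finally show "2 * (K + 1) \<le> L1_weight \<alpha> T r N n (n - m) / Gamma (2 - \<alpha>)"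
          unfolding \<delta>q[symmetric] using G by (intro divide_right_mono) auto
      qed (use mono[of m n] mn in simp)
      also have "\<dots> \<le> (\<Sum>j\<le>n. L1_coeff \<alpha> T r N n j * w j)"
        using assms N mn mono by (intro sum_L1_coeff_ge_jump) auto
      finally show "K * w n + F \<le> (\<Sum>j\<le>n. L1_coeff \<alpha> T r N n j * w j)" .
    qed (use sub F n in \<open>auto simp: w_def A_def p_def\<close>)
    also have "\<dots> \<le> w N" using n by (rule mono)
    also have "\<dots> = 2 ^ nat \<lceil>T / \<delta>\<rceil> * (v 0 + F)"
      using N by (simp add: w_def p_def tgrid_last A_def)
    finally show ?thesis .
  qed
  then have "L1_gronwall_const \<alpha> T r K N (2 ^ nat \<lceil>T / \<delta>\<rceil>)"
    if "1 \<le> N" "tstep T r N N \<le> \<delta>" "K * Gamma (2 - \<alpha>) * tstep T r N N powr \<alpha> < 1" for N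
    using that unfolding L1_gronwall_const_def by simp
  then show ?thesis using \<delta> by (intro that[of "2 ^ nat \<lceil>T / \<delta>\<rceil>" \<delta>]) simp_all
qed

lemma L1_gronwall:
  assumes "0 < \<alpha>" "\<alpha> < 1" "0 < T" "1 \<le> r" "0 \<le> K"
  obtains C where "0 \<le> C"
    "\<And>N. 1 \<le> N \<Longrightarrow> K * Gamma (2 - \<alpha>) * tstep T r N N powr \<alpha> < 1 \<Longrightarrow>
      L1_gronwall_const \<alpha> T r K N C"
proof -
  let ?small = "\<lambda>N. K * Gamma (2 - \<alpha>) * tstep T r N N powr \<alpha> < 1"
  obtain C1 \<delta> where C1: "0 \<le> C1" "0 < \<delta>"
    and fine: "\<And>N. 1 \<le> N \<Longrightarrow> tstep T r N N \<le> \<delta> \<Longrightarrow> ?small N \<Longrightarrow> L1_gronwall_const \<alpha> T r K N C1"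
    by (rule L1_gronwall_fine_mesh[OF assms]) blast
  \<comment> \<open>Vacuous for N violating the restriction, so that choice yields a constant for
    every N.\<close>
  have "\<exists>C\<ge>0. 1 \<le> N \<longrightarrow> ?small N \<longrightarrow> L1_gronwall_const \<alpha> T r K N C" for N
    using L1_gronwall_fixed_mesh[OF assms(1-4) _ assms(5), of N]
    by (cases "1 \<le> N \<and> ?small N") auto
  then obtain C2 where C2: "\<And>N. 0 \<le> C2 N"
    "\<And>N. 1 \<le> N \<Longrightarrow> ?small N \<Longrightarrow> L1_gronwall_const \<alpha> T r K N (C2 N)"
    by metis
  have "\<forall>\<^sub>F N in sequentially. tstep T r N N < \<delta>"
    using tstep_last_tendsto_0 C1(2) by (rule order_tendstoD)
  then obtain N0 where N0: "\<And>N. N0 \<le> N \<Longrightarrow> tstep T r N N < \<delta>"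
    unfolding eventually_sequentially by blast
  \<comment> \<open>A sum bounds all exceptional constants at once, as each is nonnegative.\<close>
  define C where "C = C1 + (\<Sum>N<N0. C2 N)"
  have sum_C2: "0 \<le> (\<Sum>N<N0. C2 N)" using C2(1) by (intro sum_nonneg)
  show ?thesis
  proof (rule that)
    show "0 \<le> C" using C1 sum_C2 by (simp add: C_def)
    fix N assume N: "1 \<le> N" "?small N"
    show "L1_gronwall_const \<alpha> T r K N C"
    proof (cases "N0 \<le> N")
      case True
      then have "L1_gronwall_const \<alpha> T r K N C1" using fine[OF N(1) _ N(2)] N0[of N] by simp
      then show ?thesis
        by (rule L1_gronwall_const_mono) (use sum_C2 in \<open>simp add: C_def\<close>)
    next
      case False
      then have "C2 N \<le> (\<Sum>N<N0. C2 N)"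
        using C2(1) by (intro member_le_sum) auto
      then show ?thesis
        by (intro L1_gronwall_const_mono[OF C2(2)[OF N]]) (use C1 in \<open>simp add: C_def\<close>)
    qed
  qed
qed

section \<open>Square integrable functions\<close>

lemma L2_inner_commute: "L2_inner \<Omega> v w = L2_inner \<Omega> w v"
  by (simp add: L2_inner_def inner_commute)

lemma L2_inner_self_nonneg: "0 \<le> L2_inner \<Omega> v v"
  unfolding L2_inner_def set_lebesgue_integral_def
  by (intro Bochner_Integration.integral_nonneg) auto

lemma L2_norm_nonneg: "0 \<le> L2_norm \<Omega> v"
  by (simp add: L2_norm_def L2_inner_self_nonneg)

lemma L2_norm_square: "(L2_norm \<Omega> v)\<^sup>2 = L2_inner \<Omega> v v"
  by (simp add: L2_norm_def L2_inner_self_nonneg)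

text \<open>A crude Young inequality gives the integrable majorant. Measurability is available only
  after multiplication with the indicator of \<Omega>, hence the detour through
  \<open>eq\<close>.\<close>

lemma L2_fun_integrable:
  fixes v w :: "'a::euclidean_space \<Rightarrow> 'b::euclidean_space"
  assumes "L2_fun \<Omega> v" "L2_fun \<Omega> w"
  shows "set_integrable lebesgue \<Omega> (\<lambda>x. v x \<bullet> w x)"
proof -
  have meas: "(\<lambda>x. indicator \<Omega> x *\<^sub>R v x) \<in> borel_measurable lebesgue"
    "(\<lambda>x. indicator \<Omega> x *\<^sub>R w x) \<in> borel_measurable lebesgue"
    and int: "integrable lebesgue (\<lambda>x. indicator \<Omega> x *\<^sub>R (v x \<bullet> v x))"
    "integrable lebesgue (\<lambda>x. indicator \<Omega> x *\<^sub>R (w x \<bullet> w x))"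
    using assms by (auto simp: L2_fun_def set_borel_measurable_def set_integrable_def)
  have eq: "(indicator \<Omega> x *\<^sub>R v x) \<bullet> (indicator \<Omega> x *\<^sub>R w x) = indicator \<Omega> x *\<^sub>R (v x \<bullet> w x)" for x
    by (simp split: split_indicator)
  have young: "\<bar>y \<bullet> z\<bar> \<le> y \<bullet> y + z \<bullet> z" for y z :: 'b
  proof -
    have "0 \<le> (y + z) \<bullet> (y + z)" "0 \<le> (y - z) \<bullet> (y - z)" "0 \<le> y \<bullet> y" "0 \<le> z \<bullet> z"
      by simp_all
    then show ?thesis by (simp add: inner_simps inner_commute)
  qed
  have "integrable lebesgue (\<lambda>x. indicator \<Omega> x *\<^sub>R (v x \<bullet> w x))"
  proof (rule Bochner_Integration.integrable_bound[OF Bochner_Integration.integrable_add[OF int]])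
    show "(\<lambda>x. indicator \<Omega> x *\<^sub>R (v x \<bullet> w x)) \<in> borel_measurable lebesgue"
      using borel_measurable_inner[OF meas] by (simp only: eq)
    show "AE x in lebesgue. norm (indicator \<Omega> x *\<^sub>R (v x \<bullet> w x))
        \<le> norm (indicator \<Omega> x *\<^sub>R (v x \<bullet> v x) + indicator \<Omega> x *\<^sub>R (w x \<bullet> w x))"
      using young by (intro AE_I2) (auto split: split_indicator intro: order_trans)
  qed
  then show ?thesis by (simp add: set_integrable_def)
qed

lemma set_borel_measurable_bound_integrable:
  fixes u :: "'a::euclidean_space \<Rightarrow> real"
  assumes "set_borel_measurable lebesgue \<Omega> u" "set_integrable lebesgue \<Omega> w"
    and "\<And>x. x \<in> \<Omega> \<Longrightarrow> \<bar>u x\<bar> \<le> w x"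
  shows "set_integrable lebesgue \<Omega> u"
  using assms(1,2) unfolding set_integrable_def set_borel_measurable_def
  by (elim Bochner_Integration.integrable_bound)
     (auto intro!: AE_I2 split: split_indicator dest: assms(3))

lemma L2_fun_zero: "L2_fun \<Omega> (\<lambda>x. 0)"
  by (simp add: L2_fun_def set_borel_measurable_def set_integrable_def)

lemma L2_fun_bound:
  fixes v :: "'a::euclidean_space \<Rightarrow> 'b::euclidean_space" and w :: "'a \<Rightarrow> 'c::euclidean_space"
  assumes "L2_fun \<Omega> v" "set_borel_measurable lebesgue \<Omega> w"
    and bound: "\<And>x. x \<in> \<Omega> \<Longrightarrow> norm (w x) \<le> c * norm (v x)"
  shows "L2_fun \<Omega> w"
proof -
  have v: "set_integrable lebesgue \<Omega> (\<lambda>x. v x \<bullet> v x)" using assms by (simp add: L2_fun_def)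
  have meas: "(\<lambda>x. indicator \<Omega> x *\<^sub>R w x) \<in> borel_measurable lebesgue"
    using assms by (simp add: set_borel_measurable_def)
  have eq: "(indicator \<Omega> x *\<^sub>R w x) \<bullet> (indicator \<Omega> x *\<^sub>R w x) = indicator \<Omega> x *\<^sub>R (w x \<bullet> w x)" for x
    by (simp split: split_indicator)
  have "set_integrable lebesgue \<Omega> (\<lambda>x. w x \<bullet> w x)"
  proof (rule set_borel_measurable_bound_integrable[where w = "\<lambda>x. c\<^sup>2 * (v x \<bullet> v x)"])
    show "set_borel_measurable lebesgue \<Omega> (\<lambda>x. w x \<bullet> w x)"
      using borel_measurable_inner[OF meas meas] by (simp only: eq set_borel_measurable_def)
    show "set_integrable lebesgue \<Omega> (\<lambda>x. c\<^sup>2 * (v x \<bullet> v x))"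
      using v by (rule set_integrable_mult_right)
    show "\<bar>w x \<bullet> w x\<bar> \<le> c\<^sup>2 * (v x \<bullet> v x)" if "x \<in> \<Omega>" for x
      using power_mono[OF bound[OF that] norm_ge_zero, of 2]
      by (simp add: power_mult_distrib power2_norm_eq_inner)
  qed
  then show ?thesis using assms by (simp add: L2_fun_def)
qed

lemma L2_norm_bound:
  fixes v :: "'a::euclidean_space \<Rightarrow> 'b::euclidean_space" and w :: "'a \<Rightarrow> 'c::euclidean_space"
  assumes "L2_fun \<Omega> v" "L2_fun \<Omega> w" "0 \<le> c"
    and bound: "\<And>x. x \<in> \<Omega> \<Longrightarrow> norm (w x) \<le> c * norm (v x)"
  shows "L2_norm \<Omega> w \<le> c * L2_norm \<Omega> v"
proof -
  have "L2_inner \<Omega> w w \<le> (LINT x:\<Omega>|lebesgue. c\<^sup>2 * (v x \<bullet> v x))"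
    unfolding L2_inner_def
  proof (rule set_integral_mono)
    show "w x \<bullet> w x \<le> c\<^sup>2 * (v x \<bullet> v x)" if "x \<in> \<Omega>" for x
      using power_mono[OF bound[OF that] norm_ge_zero, of 2]
      by (simp add: power_mult_distrib power2_norm_eq_inner)
  qed (use assms in \<open>auto simp: L2_fun_def\<close>)
  also have "\<dots> = c\<^sup>2 * L2_inner \<Omega> v v" by (simp add: L2_inner_def)
  finally have "sqrt (L2_inner \<Omega> w w) \<le> sqrt (c\<^sup>2 * L2_inner \<Omega> v v)" by simp
  then show ?thesis using \<open>0 \<le> c\<close> by (simp add: L2_norm_def real_sqrt_mult)
qed

lemma L2_fun_scaleR:
  fixes v :: "'a::euclidean_space \<Rightarrow> 'b::euclidean_space"
  assumes "L2_fun \<Omega> v"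
  shows "L2_fun \<Omega> (\<lambda>x. c *\<^sub>R v x)"
proof (rule L2_fun_bound[OF assms])
  have "(\<lambda>x. indicator \<Omega> x *\<^sub>R v x) \<in> borel_measurable lebesgue"
    using assms by (simp only: L2_fun_def set_borel_measurable_def)
  then have "(\<lambda>x. c *\<^sub>R (indicator \<Omega> x *\<^sub>R v x)) \<in> borel_measurable lebesgue"
    by (rule borel_measurable_const_scaleR)
  moreover have "c *\<^sub>R (indicator \<Omega> x *\<^sub>R v x) = indicator \<Omega> x *\<^sub>R (c *\<^sub>R v x)" for x
    by (rule scaleR_left_commute)
  ultimately show "set_borel_measurable lebesgue \<Omega> (\<lambda>x. c *\<^sub>R v x)"
    by (simp only: set_borel_measurable_def)
  show "norm (c *\<^sub>R v x) \<le> \<bar>c\<bar> * norm (v x)" for x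
    by (rule eq_refl[OF norm_scaleR])
qed

lemma L2_fun_add:
  fixes v w :: "'a::euclidean_space \<Rightarrow> 'b::euclidean_space"
  assumes v: "L2_fun \<Omega> v" and w: "L2_fun \<Omega> w"
  shows "L2_fun \<Omega> (\<lambda>x. v x + w x)"
proof -
  have meas: "set_borel_measurable lebesgue \<Omega> (\<lambda>x. v x + w x)"
    using assms borel_measurable_add[of "\<lambda>x. indicator \<Omega> x *\<^sub>R v x" lebesgue "\<lambda>x. indicator \<Omega> x *\<^sub>R w x"]
    by (simp add: L2_fun_def set_borel_measurable_def scaleR_add_right)
  have "set_integrable lebesgue \<Omega> (\<lambda>x. (v x \<bullet> v x + v x \<bullet> w x) + (w x \<bullet> v x + w x \<bullet> w x))"
    using L2_fun_integrable[OF v v] L2_fun_integrable[OF v w]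
      L2_fun_integrable[OF w v] L2_fun_integrable[OF w w]
    by (intro set_integral_add)
  moreover have "(v x \<bullet> v x + v x \<bullet> w x) + (w x \<bullet> v x + w x \<bullet> w x) = (v x + w x) \<bullet> (v x + w x)" for x
    by (simp add: inner_simps inner_commute)
  ultimately show ?thesis
    using meas by (simp add: L2_fun_def)
qed

lemma L2_fun_sum:
  fixes V :: "'i \<Rightarrow> 'a::euclidean_space \<Rightarrow> 'b::euclidean_space"
  assumes "\<And>j. j \<in> I \<Longrightarrow> L2_fun \<Omega> (V j)"
  shows "L2_fun \<Omega> (\<lambda>x. \<Sum>j\<in>I. c j *\<^sub>R V j x)"
  using assms
  by (induction I rule: infinite_finite_induct) (auto intro!: L2_fun_zero L2_fun_add L2_fun_scaleR)

lemma L2_inner_sum_left: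
  fixes V :: "'i \<Rightarrow> 'a::euclidean_space \<Rightarrow> 'b::euclidean_space"
  assumes "finite I" and V: "\<And>j. j \<in> I \<Longrightarrow> L2_fun \<Omega> (V j)" and w: "L2_fun \<Omega> w"
  shows "L2_inner \<Omega> (\<lambda>x. \<Sum>j\<in>I. c j *\<^sub>R V j x) w = (\<Sum>j\<in>I. c j * L2_inner \<Omega> (V j) w)"
proof -
  have "(\<Sum>j\<in>I. c j * L2_inner \<Omega> (V j) w) = (\<Sum>j\<in>I. (LINT x:\<Omega>|lebesgue. c j * (V j x \<bullet> w x)))"
    by (simp add: L2_inner_def)
  also have "\<dots> = (LINT x|lebesgue. (\<Sum>j\<in>I. indicator \<Omega> x *\<^sub>R (c j * (V j x \<bullet> w x))))"
    unfolding set_lebesgue_integral_def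
  proof (rule Bochner_Integration.integral_sum[symmetric])
    fix j assume "j \<in> I"
    then have "set_integrable lebesgue \<Omega> (\<lambda>x. c j * (V j x \<bullet> w x))"
      using assms by (intro set_integrable_mult_right L2_fun_integrable) auto
    then show "integrable lebesgue (\<lambda>x. indicator \<Omega> x *\<^sub>R (c j * (V j x \<bullet> w x)))"
      by (simp add: set_integrable_def)
  qed
  finally show ?thesis
    by (simp add: L2_inner_def set_lebesgue_integral_def inner_sum_left sum_distrib_left)
qed

text \<open>Functions are not identified almost everywhere, so the form is only semidefinite.
  Nonnegativity of a quadratic form in s and t also handles a w of norm zero.\<close>

lemma L2_Cauchy_Schwarz:
  fixes v w :: "'a::euclidean_space \<Rightarrow> 'b::euclidean_space"
  assumes v: "L2_fun \<Omega> v" and w: "L2_fun \<Omega> w"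
  shows "L2_inner \<Omega> v w \<le> L2_norm \<Omega> v * L2_norm \<Omega> w"
proof -
  define A B C where "A = L2_inner \<Omega> v v" "B = L2_inner \<Omega> v w" "C = L2_inner \<Omega> w w"
  have quad: "0 \<le> s\<^sup>2 * A + 2 * (s * t) * B + t\<^sup>2 * C" for s t
  proof -
    \<comment> \<open>Summing over the two truth values makes a combination of two functions an
      instance of \<open>L2_inner_sum_left\<close>.\<close>
    let ?u = "\<lambda>x. \<Sum>j\<in>{False, True}. (if j then t else s) *\<^sub>R (if j then w else v) x"
    have uu: "L2_fun \<Omega> ?u" using assms by (intro L2_fun_sum) auto
    have expand: "L2_inner \<Omega> ?u z = s * L2_inner \<Omega> v z + t * L2_inner \<Omega> w z" if "L2_fun \<Omega> z" for z
      using that assms by (subst L2_inner_sum_left) auto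
    have "0 \<le> L2_inner \<Omega> ?u ?u" by (rule L2_inner_self_nonneg)
    also have "L2_inner \<Omega> ?u ?u = s * L2_inner \<Omega> ?u v + t * L2_inner \<Omega> ?u w"
      using expand[OF uu] by (metis (no_types, lifting) L2_inner_commute)
    also have "\<dots> = s\<^sup>2 * A + 2 * (s * t) * B + t\<^sup>2 * C"
      unfolding expand[OF v] expand[OF w] A_B_C_def L2_inner_commute[of \<Omega> w v]
      by (simp add: algebra_simps power2_eq_square)
    finally show ?thesis .
  qed
  have AC: "0 \<le> A" "0 \<le> C" by (simp_all add: A_B_C_def L2_inner_self_nonneg)
  have "B\<^sup>2 \<le> A * C"
  proof (cases "C = 0")
    case True
    have "0 \<le> B\<^sup>2 * A + 2 * (B * t) * B" for t using quad[of B t] True by simp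
    \<comment> \<open>With s = B and t = - (A + 1) the form equals - (A + 2) B^2, which forces B =
      0.\<close>
    then have "0 \<le> B\<^sup>2 * A + 2 * (B * (- (A + 1))) * B" .
    also have "\<dots> = - ((A + 2) * B\<^sup>2)" by (simp add: algebra_simps power2_eq_square)
    finally have "B\<^sup>2 \<le> 0" using AC by (simp add: mult_le_0_iff)
    then show ?thesis using True by simp
  next
    case False
    have "0 \<le> C * (A * C - B\<^sup>2)" using quad[of C "- B"] by (simp add: algebra_simps power2_eq_square)
    then show ?thesis using False AC by (simp add: zero_le_mult_iff)
  qed
  then have "\<bar>B\<bar> \<le> sqrt (A * C)" by (simp add: real_le_rsqrt)
  then show ?thesis by (simp add: A_B_C_def L2_norm_def real_sqrt_mult)
qed

text \<open>An almost everywhere bound is the right form because gradients of finite element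
  functions are controlled only off the element boundaries.\<close>

lemma L2_fun_bounded:
  fixes v :: "'a::euclidean_space \<Rightarrow> 'b::euclidean_space"
  assumes "\<Omega> \<in> lmeasurable" "set_borel_measurable lebesgue \<Omega> v"
    and bound: "AE x in lebesgue. x \<in> \<Omega> \<longrightarrow> norm (v x) \<le> B"
  shows "L2_fun \<Omega> v"
proof -
  have meas: "(\<lambda>x. indicator \<Omega> x *\<^sub>R v x) \<in> borel_measurable lebesgue"
    using assms by (simp add: set_borel_measurable_def)
  have eq: "(indicator \<Omega> x *\<^sub>R v x) \<bullet> (indicator \<Omega> x *\<^sub>R v x) = indicator \<Omega> x *\<^sub>R (v x \<bullet> v x)" for x
    by (simp split: split_indicator)
  have "integrable lebesgue (\<lambda>x. indicator \<Omega> x *\<^sub>R (v x \<bullet> v x))"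
  proof (rule Bochner_Integration.integrable_bound)
    show "integrable lebesgue (\<lambda>x. indicator \<Omega> x *\<^sub>R B\<^sup>2)"
      using assms(1) by (auto simp: fmeasurable_def intro!: integrable_real_indicator)
    show "(\<lambda>x. indicator \<Omega> x *\<^sub>R (v x \<bullet> v x)) \<in> borel_measurable lebesgue"
      using borel_measurable_inner[OF meas meas] by (simp only: eq)
    show "AE x in lebesgue. norm (indicator \<Omega> x *\<^sub>R (v x \<bullet> v x)) \<le> norm (indicator \<Omega> x *\<^sub>R B\<^sup>2)"
      using bound
    proof eventually_elim
      case (elim x)
      then show ?case
        using power_mono[of "norm (v x)" B 2] by (auto simp: power2_norm_eq_inner split: split_indicator)
    qed
  qed
  then show ?thesis using assms by (simp add: L2_fun_def set_integrable_def)
qed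

lemma L2_inner_cong_AE:
  assumes "AE x in lebesgue. x \<in> \<Omega> \<longrightarrow> v x \<bullet> w x = v' x \<bullet> w' x"
    "set_integrable lebesgue \<Omega> (\<lambda>x. v x \<bullet> w x)" "set_integrable lebesgue \<Omega> (\<lambda>x. v' x \<bullet> w' x)"
  shows "L2_inner \<Omega> v w = L2_inner \<Omega> v' w'"
  using assms unfolding L2_inner_def set_lebesgue_integral_def set_integrable_def
  by (intro integral_cong_AE) (auto elim!: eventually_mono split: split_indicator)

lemma L2_fun_abs:
  fixes u :: "'a::euclidean_space \<Rightarrow> real"
  assumes "L2_fun \<Omega> u"
  shows "L2_fun \<Omega> (\<lambda>x. \<bar>u x\<bar>)"
proof -
  have "(\<lambda>x. indicator \<Omega> x *\<^sub>R u x) \<in> borel_measurable lebesgue"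
    using assms by (simp add: L2_fun_def set_borel_measurable_def)
  then have "(\<lambda>x. \<bar>indicator \<Omega> x *\<^sub>R u x\<bar>) \<in> borel_measurable lebesgue"
    by (rule borel_measurable_abs)
  moreover have "\<bar>indicator \<Omega> x *\<^sub>R u x\<bar> = indicator \<Omega> x *\<^sub>R \<bar>u x\<bar>" for x
    by (simp split: split_indicator)
  ultimately show ?thesis
    using assms by (simp only: L2_fun_def set_borel_measurable_def) simp
qed

lemma L2_norm_abs: "L2_norm \<Omega> (\<lambda>x. \<bar>u x\<bar>) = L2_norm \<Omega> (u :: 'a::euclidean_space \<Rightarrow> real)"
  by (simp add: L2_norm_def L2_inner_def)

lemma L2_fun_const:
  fixes c :: "'b::euclidean_space"
  assumes "\<Omega> \<in> lmeasurable"
  shows "L2_fun \<Omega> (\<lambda>x. c)"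
proof (rule L2_fun_bounded[OF assms])
  have "indicator \<Omega> \<in> borel_measurable lebesgue"
    using assms by (intro borel_measurable_indicator) auto
  then show "set_borel_measurable lebesgue \<Omega> (\<lambda>x. c)"
    unfolding set_borel_measurable_def by (intro borel_measurable_scaleR borel_measurable_const)
  show "AE x in lebesgue. x \<in> \<Omega> \<longrightarrow> norm c \<le> norm c" by simp
qed

section \<open>The nonlinear term and discrete energy inequalities\<close>

lemma set_borel_measurable_continuous_comp:
  fixes f :: "real \<Rightarrow> real"
  assumes \<Omega>: "\<Omega> \<in> sets lebesgue" and f: "continuous_on UNIV f"
    and u: "set_borel_measurable lebesgue \<Omega> u"
  shows "set_borel_measurable lebesgue \<Omega> (\<lambda>x. f (u x))"
proof -
  have "(\<lambda>x. f (indicator \<Omega> x *\<^sub>R u x)) \<in> borel_measurable lebesgue"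
    using u by (intro borel_measurable_continuous_on[OF f]) (simp only: set_borel_measurable_def)
  then have "(\<lambda>x. indicator \<Omega> x *\<^sub>R f (indicator \<Omega> x *\<^sub>R u x)) \<in> borel_measurable lebesgue"
    by (rule borel_measurable_scaleR[OF borel_measurable_indicator[OF \<Omega>]])
  moreover have "indicator \<Omega> x *\<^sub>R f (indicator \<Omega> x *\<^sub>R u x) = indicator \<Omega> x *\<^sub>R f (u x)" for x
    by (simp split: split_indicator)
  ultimately show ?thesis by (simp only: set_borel_measurable_def)
qed

text \<open>Lipschitz continuity gives linear growth about 0; the constant part enters through the
  norm of 1 on \<Omega>. It serves for both test functions, the solution and its discrete
  derivative.\<close>

lemma L2_inner_lipschitz_le:
  fixes u w :: "'a::euclidean_space \<Rightarrow> real"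
  assumes \<Omega>: "\<Omega> \<in> lmeasurable" and f: "K-lipschitz_on UNIV f"
    and u: "L2_fun \<Omega> u" and w: "L2_fun \<Omega> w"
  shows "L2_inner \<Omega> (\<lambda>x. f (u x)) w
    \<le> (K * L2_norm \<Omega> u + \<bar>f 0\<bar> * sqrt (measure lebesgue \<Omega>)) * L2_norm \<Omega> w"
proof -
  have K: "0 \<le> K" using f by (rule lipschitz_on_nonneg)
  have f_le: "\<bar>f y\<bar> \<le> K * \<bar>y\<bar> + \<bar>f 0\<bar>" for y
    using lipschitz_onD[OF f, of y 0] by (simp add: dist_real_def)
  note u' = L2_fun_abs[OF u] and w' = L2_fun_abs[OF w]
  have one: "L2_fun \<Omega> (\<lambda>x. 1::real)" using \<Omega> by (rule L2_fun_const)
  have norm_one: "L2_norm \<Omega> (\<lambda>x. 1::real) = sqrt (measure lebesgue \<Omega>)"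
    using \<Omega> by (simp add: L2_norm_def L2_inner_def set_lebesgue_integral_def)
  let ?g = "\<lambda>x. K * \<bar>u x\<bar> + \<bar>f 0\<bar>"
  have g: "L2_fun \<Omega> ?g"
    using L2_fun_add[OF L2_fun_scaleR[OF u', of K] L2_fun_const[OF \<Omega>, of "\<bar>f 0\<bar>"]]
    by (simp only: real_scaleR_def)
  have fu: "L2_fun \<Omega> (\<lambda>x. f (u x))"
  proof (rule L2_fun_bound[OF g])
    show "set_borel_measurable lebesgue \<Omega> (\<lambda>x. f (u x))"
      using u by (intro set_borel_measurable_continuous_comp[OF fmeasurableD[OF \<Omega>]
          lipschitz_on_continuous_on[OF f]]) (simp only: L2_fun_def)
    show "norm (f (u x)) \<le> 1 * norm (?g x)" for x
      using f_le[of "u x"] abs_ge_self[of "?g x"] unfolding real_norm_def mult_1 by (rule order_trans)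
  qed
  have "L2_inner \<Omega> (\<lambda>x. f (u x)) w \<le> L2_inner \<Omega> ?g (\<lambda>x. \<bar>w x\<bar>)"
    unfolding L2_inner_def
  proof (rule set_integral_mono[OF L2_fun_integrable[OF fu w] L2_fun_integrable[OF g w']])
    fix x
    have "f (u x) * w x \<le> \<bar>f (u x)\<bar> * \<bar>w x\<bar>"
      using abs_ge_self[of "f (u x) * w x"] by (simp only: abs_mult)
    also have "\<dots> \<le> ?g x * \<bar>w x\<bar>" using f_le by (intro mult_right_mono) auto
    finally show "f (u x) \<bullet> w x \<le> ?g x \<bullet> \<bar>w x\<bar>" by (simp only: inner_real_def)
  qed
  also have "\<dots> = K * L2_inner \<Omega> (\<lambda>x. \<bar>u x\<bar>) (\<lambda>x. \<bar>w x\<bar>) + \<bar>f 0\<bar> * L2_inner \<Omega> (\<lambda>x. 1) (\<lambda>x. \<bar>w x\<bar>)"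
  proof -
    let ?V = "\<lambda>j::bool. if j then (\<lambda>x. 1) else (\<lambda>x. \<bar>u x\<bar>)"
    let ?c = "\<lambda>j::bool. if j then \<bar>f 0\<bar> else K"
    have "L2_inner \<Omega> (\<lambda>x. \<Sum>j\<in>{False, True}. ?c j *\<^sub>R ?V j x) (\<lambda>x. \<bar>w x\<bar>)
        = (\<Sum>j\<in>{False, True}. ?c j * L2_inner \<Omega> (?V j) (\<lambda>x. \<bar>w x\<bar>))"
      using u' w' one by (intro L2_inner_sum_left) auto
    then show ?thesis by simp
  qed
  also have "\<dots> \<le> K * (L2_norm \<Omega> u * L2_norm \<Omega> w) + \<bar>f 0\<bar> * (sqrt (measure lebesgue \<Omega>) * L2_norm \<Omega> w)"
  proof (intro add_mono mult_left_mono)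
    show "L2_inner \<Omega> (\<lambda>x. \<bar>u x\<bar>) (\<lambda>x. \<bar>w x\<bar>) \<le> L2_norm \<Omega> u * L2_norm \<Omega> w"
      using L2_Cauchy_Schwarz[OF u' w'] by (simp only: L2_norm_abs)
    show "L2_inner \<Omega> (\<lambda>x. 1) (\<lambda>x. \<bar>w x\<bar>) \<le> sqrt (measure lebesgue \<Omega>) * L2_norm \<Omega> w"
      using L2_Cauchy_Schwarz[OF one w'] by (simp only: L2_norm_abs norm_one)
  qed (use K in auto)
  also have "\<dots> = (K * L2_norm \<Omega> u + \<bar>f 0\<bar> * sqrt (measure lebesgue \<Omega>)) * L2_norm \<Omega> w"
    by (simp only: distrib_right mult.assoc)
  finally show ?thesis .
qed

text \<open>Nonpositive history coefficients turn Cauchy-Schwarz into a lower bound, and the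
  diagonal term is an equality. The discrete derivative thus passes from functions to their
  norms.\<close>

lemma L2_inner_sum_ge:
  fixes V :: "nat \<Rightarrow> 'a::euclidean_space \<Rightarrow> 'b::euclidean_space"
  assumes V: "\<And>j. j \<le> n \<Longrightarrow> L2_fun \<Omega> (V j)" and c: "\<And>j. j < n \<Longrightarrow> c j \<le> 0"
  shows "L2_norm \<Omega> (V n) * (\<Sum>j\<le>n. c j * L2_norm \<Omega> (V j))
    \<le> L2_inner \<Omega> (\<lambda>x. \<Sum>j\<le>n. c j *\<^sub>R V j x) (V n)"
proof -
  have "L2_norm \<Omega> (V n) * (\<Sum>j\<le>n. c j * L2_norm \<Omega> (V j))
      = (\<Sum>j\<le>n. c j * (L2_norm \<Omega> (V j) * L2_norm \<Omega> (V n)))"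
    by (simp add: sum_distrib_left mult_ac)
  also have "\<dots> \<le> (\<Sum>j\<le>n. c j * L2_inner \<Omega> (V j) (V n))"
  proof (rule sum_mono)
    fix j assume j: "j \<in> {..n}"
    show "c j * (L2_norm \<Omega> (V j) * L2_norm \<Omega> (V n)) \<le> c j * L2_inner \<Omega> (V j) (V n)"
    proof (cases "j = n")
      case True
      then show ?thesis by (simp add: L2_norm_square[symmetric] power2_eq_square)
    next
      case False
      then show ?thesis
        using j V c L2_Cauchy_Schwarz[of \<Omega> "V j" "V n"] by (intro mult_left_mono_neg) auto
    qed
  qed
  also have "\<dots> = L2_inner \<Omega> (\<lambda>x. \<Sum>j\<le>n. c j *\<^sub>R V j x) (V n)"
    using V by (subst L2_inner_sum_left) auto
  finally show ?thesis .
qed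

text \<open>Discrete form of (y^2)' / 2 = y y'. It becomes an inequality by 2 y_n y_j \<le> y_n^2 +
  y_j^2 on the history.\<close>

lemma half_sum_squares_le:
  fixes y :: "nat \<Rightarrow> real"
  assumes c: "\<And>j. j < n \<Longrightarrow> c j \<le> 0" and "(\<Sum>j\<le>n. c j) = 0"
  shows "(\<Sum>j\<le>n. c j * (y j)\<^sup>2) / 2 \<le> y n * (\<Sum>j\<le>n. c j * y j)"
proof -
  \<comment> \<open>The inserted squares of \<open>y n\<close> cancel by the zero row sum.\<close>
  have "(\<Sum>j\<le>n. c j * (y j)\<^sup>2) / 2 = (\<Sum>j\<le>n. c j * (((y j)\<^sup>2 + (y n)\<^sup>2) / 2))"
  proof -
    have "(\<Sum>j\<le>n. c j * (((y j)\<^sup>2 + (y n)\<^sup>2) / 2)) = (\<Sum>j\<le>n. c j * (y j)\<^sup>2) / 2 + (\<Sum>j\<le>n. c j) * ((y n)\<^sup>2 / 2)"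
      unfolding sum_divide_distrib sum_distrib_right sum.distrib[symmetric]
      by (intro sum.cong refl) (simp only: add_divide_distrib distrib_left times_divide_eq_right)
    then show ?thesis using assms by simp
  qed
  also have "\<dots> \<le> (\<Sum>j\<le>n. c j * (y n * y j))"
  proof (rule sum_mono)
    fix j assume j: "j \<in> {..n}"
    have "y n * y j \<le> ((y j)\<^sup>2 + (y n)\<^sup>2) / 2"
      using zero_le_power2[of "y j - y n"] by (simp add: power2_diff mult_ac)
    moreover have "y j * y j = ((y j)\<^sup>2 + (y j)\<^sup>2) / 2" by (simp add: power2_eq_square)
    ultimately show "c j * (((y j)\<^sup>2 + (y n)\<^sup>2) / 2) \<le> c j * (y n * y j)"
      using j c[of j] mult_left_mono_neg[of "y n * y j" "((y j)\<^sup>2 + (y n)\<^sup>2) / 2" "c j"]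
      by (cases "j = n") simp_all
  qed
  finally show ?thesis by (simp add: sum_distrib_left mult_ac)
qed

section \<open>Piecewise affine functions\<close>

text \<open>An open set of full measure, common to all functions of the space, on which their
  gradients exist and are locally constant. The complement of the mesh belongs to it because the
  functions vanish there.\<close>

definition mesh_regular :: "'a::euclidean_space set set \<Rightarrow> 'a set" where
  "mesh_regular \<T> = (\<Union>S\<in>\<T>. interior S) \<union> - \<Union>\<T>"

lemma fe_partition_elements:
  assumes "fe_partition \<gamma> \<Omega> \<T>"
  shows "finite \<T>" "\<And>S. S \<in> \<T> \<Longrightarrow> compact S" "\<And>S. S \<in> \<T> \<Longrightarrow> convex S" "\<Union>\<T> \<subseteq> closure \<Omega>"
  using assms unfolding fe_partition_def triangulation_def
  by (auto dest!: simplex_imp_polytope intro: polytope_imp_compact polytope_imp_convex)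

lemma closed_Union_fe_partition:
  assumes "fe_partition \<gamma> \<Omega> \<T>"
  shows "closed (\<Union>\<T>)"
  using fe_partition_elements[OF assms] by (intro closed_Union) (auto intro: compact_imp_closed)

lemma open_mesh_regular:
  assumes "fe_partition \<gamma> \<Omega> \<T>"
  shows "open (mesh_regular \<T>)"
  using closed_Union_fe_partition[OF assms] unfolding mesh_regular_def
  by (intro open_Un open_UN open_Compl) auto

lemma AE_mesh_regular:
  assumes "fe_partition \<gamma> \<Omega> \<T>"
  shows "AE x in lebesgue. x \<in> mesh_regular \<T>"
proof -
  have "negligible (\<Union>S\<in>\<T>. frontier S)"
    using fe_partition_elements[OF assms] by (intro negligible_Union) (auto intro: negligible_convex_frontier)
  then have "negligible (- mesh_regular \<T>)"
  proof (rule negligible_subset)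
    show "- mesh_regular \<T> \<subseteq> (\<Union>S\<in>\<T>. frontier S)"
      using closure_subset by (fastforce simp: mesh_regular_def frontier_def)
  qed
  then have "- mesh_regular \<T> \<in> null_sets lebesgue" by (simp add: negligible_iff_null_sets)
  then show ?thesis by (rule AE_I') auto
qed

section \<open>Gradients and regularity of finite element functions\<close>

lemma grad_eq:
  assumes "GDERIV u x :> D"
  shows "grad u x = D"
  unfolding grad_def
proof (rule the_equality)
  show "GDERIV u x :> D" by (rule assms)
next
  fix E assume "GDERIV u x :> E"
  then have "(\<lambda>h. h \<bullet> E) = (\<lambda>h. h \<bullet> D)"
    using assms unfolding gderiv_def by (rule has_derivative_unique)
  then have "(E - D) \<bullet> E = (E - D) \<bullet> D" by (rule fun_cong)
  then have "(E - D) \<bullet> (E - D) = 0" by (simp add: inner_diff_right)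
  then show "E = D" by simp
qed

lemma P1_space_gradient:
  assumes part: "fe_partition \<gamma> \<Omega> \<T>" and v: "v \<in> P1_space \<Omega> \<T>"
  obtains b where "\<And>S x y. S \<in> \<T> \<Longrightarrow> x \<in> S \<Longrightarrow> y \<in> S \<Longrightarrow> v x - v y = b S \<bullet> (x - y)"
    "\<And>S x. S \<in> \<T> \<Longrightarrow> x \<in> interior S \<Longrightarrow> GDERIV v x :> b S"
    "\<And>x. x \<notin> \<Union>\<T> \<Longrightarrow> GDERIV v x :> 0"
proof -
  have "\<forall>S\<in>\<T>. \<exists>b. \<exists>c. \<forall>x\<in>S. v x = b \<bullet> x + c" using v by (simp add: P1_space_def)
  then obtain b where "\<forall>S\<in>\<T>. \<exists>c. \<forall>x\<in>S. v x = b S \<bullet> x + c" by metis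
  then obtain c where bc: "\<And>S x. S \<in> \<T> \<Longrightarrow> x \<in> S \<Longrightarrow> v x = b S \<bullet> x + c S" by metis
  show ?thesis
  proof (rule that)
    show "v x - v y = b S \<bullet> (x - y)" if "S \<in> \<T>" "x \<in> S" "y \<in> S" for S x y
      using bc that by (simp add: inner_diff_right)
    show "GDERIV v x :> b S" if "S \<in> \<T>" "x \<in> interior S" for S x
    proof -
      have "((\<lambda>y. b S \<bullet> y + c S) has_derivative (\<lambda>h. h \<bullet> b S)) (at x)"
        by (auto intro!: derivative_eq_intros simp: inner_commute)
      then show ?thesis unfolding gderiv_def
        by (rule has_derivative_transform_within_open[OF _ open_interior that(2)])
           (use bc that interior_subset in \<open>metis subsetD\<close>)
    qed
    show "GDERIV v x :> 0" if "x \<notin> \<Union>\<T>" for x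
    proof -
      have "((\<lambda>y. 0) has_derivative (\<lambda>h. h \<bullet> 0)) (at x)" by simp
      then show ?thesis unfolding gderiv_def
        by (rule has_derivative_transform_within_open[of _ _ _ _ "- \<Union>\<T>"])
           (use v that closed_Union_fe_partition[OF part] in \<open>auto simp: P1_space_def\<close>)
    qed
  qed
qed

lemma P1_space_GDERIV_grad:
  assumes "fe_partition \<gamma> \<Omega> \<T>" "v \<in> P1_space \<Omega> \<T>" "x \<in> mesh_regular \<T>"
  shows "GDERIV v x :> grad v x"
proof -
  obtain b where "\<And>S x. S \<in> \<T> \<Longrightarrow> x \<in> interior S \<Longrightarrow> GDERIV v x :> b S"
    "\<And>x. x \<notin> \<Union>\<T> \<Longrightarrow> GDERIV v x :> 0"
    using P1_space_gradient[OF assms(1,2)] by metis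
  then have "\<exists>D. GDERIV v x :> D" using assms(3) unfolding mesh_regular_def by blast
  then show ?thesis using grad_eq by metis
qed

text \<open>The gradient is constant on each open piece; continuity there is the source of its
  measurability.\<close>

lemma continuous_on_grad_P1_space:
  assumes part: "fe_partition \<gamma> \<Omega> \<T>" and v: "v \<in> P1_space \<Omega> \<T>"
  shows "continuous_on (mesh_regular \<T>) (grad v)"
proof -
  obtain b where b: "\<And>S x. S \<in> \<T> \<Longrightarrow> x \<in> interior S \<Longrightarrow> GDERIV v x :> b S"
    "\<And>x. x \<notin> \<Union>\<T> \<Longrightarrow> GDERIV v x :> 0"
    using P1_space_gradient[OF assms] by metis
  have "continuous_on (interior S) (grad v)" if "S \<in> \<T>" for S
    using continuous_on_const[of "interior S" "b S"]
    by (rule continuous_on_eq) (use b that grad_eq in metis)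
  moreover have "continuous_on (- \<Union>\<T>) (grad v)"
    using continuous_on_const[of "- \<Union>\<T>" 0]
    by (rule continuous_on_eq) (use b grad_eq in \<open>metis ComplD\<close>)
  ultimately show ?thesis
    using closed_Union_fe_partition[OF part] unfolding mesh_regular_def
    by (intro continuous_on_open_Un continuous_on_open_UN open_UN open_Compl) auto
qed

lemma bounded_grad_P1_space:
  assumes "fe_partition \<gamma> \<Omega> \<T>" "v \<in> P1_space \<Omega> \<T>"
  obtains B where "\<And>x. x \<in> mesh_regular \<T> \<Longrightarrow> norm (grad v x) \<le> B"
proof -
  obtain b where b: "\<And>S x. S \<in> \<T> \<Longrightarrow> x \<in> interior S \<Longrightarrow> GDERIV v x :> b S"
    "\<And>x. x \<notin> \<Union>\<T> \<Longrightarrow> GDERIV v x :> 0"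
    using P1_space_gradient[OF assms] by metis
  have sub: "grad v ` mesh_regular \<T> \<subseteq> insert 0 (b ` \<T>)"
  proof
    fix y assume "y \<in> grad v ` mesh_regular \<T>"
    then obtain x where x: "x \<in> mesh_regular \<T>" "y = grad v x" by blast
    then consider S where "S \<in> \<T>" "x \<in> interior S" | "x \<notin> \<Union>\<T>"
      unfolding mesh_regular_def by blast
    then show "y \<in> insert 0 (b ` \<T>)"
      using b x(2) grad_eq by cases blast+
  qed
  have "finite (insert 0 (b ` \<T>))" using fe_partition_elements(1)[OF assms(1)] by simp
  then have "bounded (grad v ` mesh_regular \<T>)"
    using sub by (meson finite_imp_bounded bounded_subset)
  then show ?thesis using that by (auto simp: bounded_iff)
qed

text \<open>Vanishing on the frontier and off the mesh covers the whole complement of \<Omega>.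
  Integrals over \<Omega> thus become integrals over the space, where translations act.\<close>

lemma P1_space_eq_0:
  assumes "fe_partition \<gamma> \<Omega> \<T>" "v \<in> P1_space \<Omega> \<T>" "open \<Omega>" "x \<notin> \<Omega>"
  shows "v x = 0"
proof (cases "x \<in> closure \<Omega>")
  case True
  then have "x \<in> frontier \<Omega>" using assms by (simp add: frontier_def interior_open)
  then show ?thesis using assms(2) by (simp add: P1_space_def)
next
  case False
  then have "x \<in> - \<Union>\<T>" using fe_partition_elements(4)[OF assms(1)] by blast
  then show ?thesis using assms(2) by (simp add: P1_space_def)
qed

lemma continuous_on_P1_space:
  assumes "fe_partition \<gamma> \<Omega> \<T>" "v \<in> P1_space \<Omega> \<T>" "open \<Omega>"
  shows "continuous_on UNIV v"
proof -
  have "continuous_on (- \<Omega>) v"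
    using continuous_on_const[of "- \<Omega>" 0]
    by (rule continuous_on_eq) (use P1_space_eq_0[OF assms] in auto)
  then have "continuous_on (closure \<Omega> \<union> - \<Omega>) v"
    using assms by (intro continuous_on_closed_Un) (auto simp: P1_space_def)
  moreover have "closure \<Omega> \<union> - \<Omega> = UNIV" using closure_subset by blast
  ultimately show ?thesis by simp
qed

lemma bounded_P1_space:
  assumes "fe_partition \<gamma> \<Omega> \<T>" "v \<in> P1_space \<Omega> \<T>" "open \<Omega>" "bounded \<Omega>"
  obtains B where "0 \<le> B" "\<And>x. \<bar>v x\<bar> \<le> B"
proof -
  have "compact (v ` closure \<Omega>)"
    using assms by (intro compact_continuous_image) (auto simp: P1_space_def compact_eq_bounded_closed bounded_closure)
  then obtain B where B: "\<And>x. x \<in> closure \<Omega> \<Longrightarrow> \<bar>v x\<bar> \<le> B"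
    using compact_imp_bounded by (fastforce simp: bounded_iff)
  show ?thesis
  proof (rule that[of "max 0 B"])
    show "\<bar>v x\<bar> \<le> max 0 B" for x
      using B[of x] P1_space_eq_0[OF assms(1-3), of x] closure_subset[of \<Omega>]
      by (cases "x \<in> \<Omega>") auto
  qed simp
qed

text \<open>The elements together with the closure of their complement form a finite closed cover of
  each segment, and the function is affine or zero on every member of the cover.\<close>

lemma lipschitz_P1_space:
  assumes "fe_partition \<gamma> \<Omega> \<T>" "v \<in> P1_space \<Omega> \<T>" "open \<Omega>"
  obtains B where "B-lipschitz_on UNIV v"
proof -
  note part = fe_partition_elements[OF assms(1)]
  obtain b where b: "\<And>S x y. S \<in> \<T> \<Longrightarrow> x \<in> S \<Longrightarrow> y \<in> S \<Longrightarrow> v x - v y = b S \<bullet> (x - y)"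
    using P1_space_gradient[OF assms(1,2)] by metis
  \<comment> \<open>Bounds all slopes at once. Its dependence on the mesh is harmless: the Lipschitz
    constant only supplies a majorant for dominated convergence.\<close>
  define B where "B = (\<Sum>S\<in>\<T>. norm (b S))"
  have B: "0 \<le> B" by (simp add: B_def sum_nonneg)
  let ?Z = "closure (- \<Union>\<T>)"
  have zero: "v x = 0" if "x \<in> ?Z" for x
  proof (rule continuous_constant_on_closure[OF _ _ that])
    show "continuous_on ?Z v"
      using continuous_on_P1_space[OF assms] continuous_on_subset by blast
  qed (use assms(2) in \<open>auto simp: P1_space_def\<close>)
  have piece: "\<bar>v x - v y\<bar> \<le> B * norm (x - y)" if "A \<in> insert ?Z \<T>" "x \<in> A" "y \<in> A" for A x y
  proof (cases "A \<in> \<T>")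
    case True
    have "\<bar>v x - v y\<bar> \<le> norm (b A) * norm (x - y)"
      using b[OF True that(2,3)] Cauchy_Schwarz_ineq2 by simp
    also have "\<dots> \<le> B * norm (x - y)"
      unfolding B_def using part(1) True by (intro mult_right_mono member_le_sum) auto
    finally show ?thesis .
  next
    case False
    then show ?thesis using zero that B by auto
  qed
  have "\<bar>v x - v y\<bar> \<le> B * norm (x - y)" for x y
  proof -
    \<comment> \<open>The cover pulls back to closed sets of parameters in [0, 1], where Lipschitz
      bounds on the members of a finite closed cover combine.\<close>
    define p where "p s = x + s *\<^sub>R (y - x)" for s :: real
    have p_diff: "p s - p t = (s - t) *\<^sub>R (y - x)" for s t
      by (simp add: p_def scaleR_diff_left)
    have p_cont: "continuous_on UNIV p" unfolding p_def by (intro continuous_intros)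
    have "(B * norm (y - x))-lipschitz_on {0..1} (\<lambda>s. v (p s))"
    proof (rule lipschitz_on_closed_Union)
      show "(B * norm (y - x))-lipschitz_on (p -` A) (\<lambda>s. v (p s))" if "A \<in> insert ?Z \<T>" for A
      proof (rule lipschitz_onI)
        fix s t assume "s \<in> p -` A" "t \<in> p -` A"
        then have "\<bar>v (p s) - v (p t)\<bar> \<le> B * norm (p s - p t)" using piece[OF that] by simp
        then show "dist (v (p s)) (v (p t)) \<le> B * norm (y - x) * dist s t"
          by (simp add: p_diff dist_real_def mult_ac)
      qed (use B in simp)
      show "closed (p -` A)" if "A \<in> insert ?Z \<T>" for A
        using that part(2) p_cont by (intro closed_vimage) (auto intro: compact_imp_closed simp: continuous_on_eq_continuous_at)
      show "finite (insert ?Z \<T>)" using part(1) by simp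
      show "0 \<le> B * norm (y - x)" using B by simp
      show "{0..1} \<subseteq> (\<Union>A\<in>insert ?Z \<T>. p -` A)"
        using closure_subset[of "- \<Union>\<T>"] by blast
    qed
    from lipschitz_onD[OF this, of 0 1] show ?thesis
      by (simp add: p_def dist_real_def norm_minus_commute)
  qed
  then have "B-lipschitz_on UNIV v"
    using B by (intro lipschitz_onI) (auto simp: dist_norm)
  then show ?thesis by (rule that)
qed

lemma L2_fun_P1_space:
  assumes "fe_partition \<gamma> \<Omega> \<T>" "v \<in> P1_space \<Omega> \<T>" "open \<Omega>" "bounded \<Omega>"
  shows "L2_fun \<Omega> v"
proof -
  obtain B where B: "\<And>x. \<bar>v x\<bar> \<le> B" using bounded_P1_space[OF assms] by metis
  have "(\<lambda>x. indicator \<Omega> x *\<^sub>R v x) \<in> borel_measurable borel"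
    using continuous_on_P1_space[OF assms(1-3)] assms(3)
    by (intro borel_measurable_continuous_on_indicator) (auto intro: continuous_on_subset)
  then have "(\<lambda>x. indicator \<Omega> x *\<^sub>R v x) \<in> borel_measurable lebesgue"
    by (simp add: measurable_completion)
  then show ?thesis
    using B assms(3,4)
    by (intro L2_fun_bounded[of _ _ B]) (auto simp: set_borel_measurable_def lmeasurable_open)
qed

text \<open>Off the regular set \<open>grad\<close> may be unspecified; completeness of Lebesgue
  measure carries measurability over the exceptional null set.\<close>

lemma L2_fun_grad_P1_space:
  assumes "fe_partition \<gamma> \<Omega> \<T>" "v \<in> P1_space \<Omega> \<T>" "open \<Omega>" "bounded \<Omega>"
  shows "L2_fun \<Omega> (grad v)"
proof -
  note AE = AE_mesh_regular[OF assms(1)]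
  obtain B where B: "\<And>x. x \<in> mesh_regular \<T> \<Longrightarrow> norm (grad v x) \<le> B"
    using bounded_grad_P1_space[OF assms(1,2)] by metis
  have "(\<lambda>x. indicator (\<Omega> \<inter> mesh_regular \<T>) x *\<^sub>R grad v x) \<in> borel_measurable borel"
    using continuous_on_grad_P1_space[OF assms(1,2)] assms(3) open_mesh_regular[OF assms(1)]
    by (intro borel_measurable_continuous_on_indicator) (auto intro: continuous_on_subset)
  then have "(\<lambda>x. indicator (\<Omega> \<inter> mesh_regular \<T>) x *\<^sub>R grad v x) \<in> borel_measurable lebesgue"
    by (simp add: measurable_completion)
  then have "(\<lambda>x. indicator \<Omega> x *\<^sub>R grad v x) \<in> borel_measurable lebesgue"
    by (rule borel_measurable_AE) (use AE in \<open>eventually_elim, auto simp: indicator_def\<close>)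
  moreover have "AE x in lebesgue. x \<in> \<Omega> \<longrightarrow> norm (grad v x) \<le> B"
    using AE by eventually_elim (use B in blast)
  ultimately show ?thesis
    using assms(3,4) by (intro L2_fun_bounded[of _ _ B]) (auto simp: set_borel_measurable_def lmeasurable_open)
qed

section \<open>Linear structure of the finite element space\<close>

lemma P1_space_lincomb:
  assumes "u \<in> P1_space \<Omega> \<T>" "v \<in> P1_space \<Omega> \<T>"
  shows "(\<lambda>x. c * u x + v x) \<in> P1_space \<Omega> \<T>"
proof -
  have "\<exists>b d. \<forall>x\<in>S. c * u x + v x = b \<bullet> x + d" if "S \<in> \<T>" for S
  proof -
    have "\<exists>b d. \<forall>x\<in>S. u x = b \<bullet> x + d" "\<exists>b d. \<forall>x\<in>S. v x = b \<bullet> x + d"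
      using assms that by (simp_all add: P1_space_def)
    then obtain b1 d1 b2 d2 where eqs: "\<forall>x\<in>S. u x = b1 \<bullet> x + d1" "\<forall>x\<in>S. v x = b2 \<bullet> x + d2"
      by (elim exE)
    have "c * u x + v x = (c *\<^sub>R b1 + b2) \<bullet> x + (c * d1 + d2)" if "x \<in> S" for x
      using bspec[OF eqs(1) that] bspec[OF eqs(2) that]
      by (simp add: inner_add_left distrib_left)
    then show ?thesis by (intro exI ballI)
  qed
  moreover have "continuous_on (closure \<Omega>) (\<lambda>x. c * u x + v x)"
    using assms by (intro continuous_on_add continuous_on_mult_left) (simp_all add: P1_space_def)
  ultimately show ?thesis
    using assms by (simp add: P1_space_def)
qed

text \<open>Makes the discrete time derivative of the solution an admissible test function.\<close>

lemma P1_space_sum: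
  assumes "\<And>j. j \<in> I \<Longrightarrow> U j \<in> P1_space \<Omega> \<T>"
  shows "(\<lambda>x. \<Sum>j\<in>I. c j * U j x) \<in> P1_space \<Omega> \<T>"
  using assms
proof (induction I rule: infinite_finite_induct)
  case (insert i I)
  then show ?case using P1_space_lincomb[of "U i"] by simp
qed (auto simp: P1_space_def intro!: exI[of _ 0])

text \<open>Restricted to regular points, where every summand is differentiable; elsewhere the
  definite description in \<open>grad\<close> need not respect sums.\<close>

lemma grad_sum_P1_space:
  assumes "fe_partition \<gamma> \<Omega> \<T>" "\<And>j. j \<in> I \<Longrightarrow> U j \<in> P1_space \<Omega> \<T>" "x \<in> mesh_regular \<T>"
  shows "grad (\<lambda>x. \<Sum>j\<in>I. c j * U j x) x = (\<Sum>j\<in>I. c j *\<^sub>R grad (U j) x)"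
proof (rule grad_eq)
  have "((\<lambda>x. \<Sum>j\<in>I. c j * U j x) has_derivative (\<lambda>h. \<Sum>j\<in>I. c j * (h \<bullet> grad (U j) x))) (at x)"
    using P1_space_GDERIV_grad[OF assms(1) assms(2) assms(3)]
    by (intro has_derivative_sum has_derivative_mult_right) (simp add: gderiv_def)
  then show "GDERIV (\<lambda>x. \<Sum>j\<in>I. c j * U j x) x :> (\<Sum>j\<in>I. c j *\<^sub>R grad (U j) x)"
    by (simp add: gderiv_def inner_sum_right)
qed

section \<open>Poincare inequality by translation invariance\<close>

lemma has_derivative_difference_quotient:
  fixes w :: "'a::real_normed_vector \<Rightarrow> real"
  assumes "(w has_derivative w') (at x)"
  shows "(\<lambda>k. (w (x + inverse (real (Suc k)) *\<^sub>R e) - w x) / inverse (real (Suc k))) \<longlonglongrightarrow> w' e"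
proof -
  have line: "((\<lambda>t. x + t *\<^sub>R e) has_derivative (\<lambda>t. t *\<^sub>R e)) (at 0)"
    by (auto intro!: derivative_eq_intros)
  have "(w has_derivative w') (at (x + 0 *\<^sub>R e))" using assms by simp
  then have "((\<lambda>t. w (x + t *\<^sub>R e)) has_derivative (\<lambda>t. w' (t *\<^sub>R e))) (at 0)"
    by (rule has_derivative_compose[OF line])
  moreover have "(\<lambda>t. w' (t *\<^sub>R e)) = (*) (w' e)"
    using has_derivative_bounded_linear[OF assms]
    by (intro ext) (simp add: linear_simps(5) mult.commute)
  ultimately have "((\<lambda>t. w (x + t *\<^sub>R e)) has_real_derivative w' e) (at 0)"
    by (simp only: has_field_derivative_def)
  then have lim: "(\<lambda>t. (w (x + (0 + t) *\<^sub>R e) - w (x + 0 *\<^sub>R e)) / t) \<midarrow>0\<rightarrow> w' e"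
    by (rule DERIV_D)
  have "filterlim (\<lambda>k. inverse (real (Suc k))) (at 0) sequentially"
    by (intro filterlim_atI LIMSEQ_inverse_real_of_nat) auto
  from filterlim_compose[OF lim this] show ?thesis by simp
qed

lemma lborel_integral_translate:
  fixes w :: "'a::euclidean_space \<Rightarrow> real"
  assumes "w \<in> borel_measurable borel"
  shows "(\<integral>x. w (x + c) \<partial>lborel) = (\<integral>x. w x \<partial>lborel)"
proof -
  have "(\<integral>x. w x \<partial>lborel) = (\<integral>x. w x \<partial>(distr lborel borel ((+) c)))"
    by (simp only: lborel_distr_plus)
  also have "\<dots> = (\<integral>x. w (c + x) \<partial>lborel)"
    using assms by (intro integral_distr) auto
  finally show ?thesis by (simp only: add.commute)
qed

lemma lborel_integrable_translate:
  fixes w :: "'a::euclidean_space \<Rightarrow> real"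
  assumes "integrable lborel w"
  shows "integrable lborel (\<lambda>x. w (x + c))"
proof -
  have "integrable (distr lborel borel ((+) c)) w"
    using assms by (simp only: lborel_distr_plus)
  then have "integrable lborel (\<lambda>x. w (c + x))"
    by (rule integrable_distr[rotated]) simp
  then show ?thesis by (simp only: add.commute)
qed

text \<open>The integral over the whole space of the derivative of \<open>(x \<bullet> e) (v x)\<^sup>2\<close> in a coordinate direction
  \<open>e\<close> vanishes, because difference quotients have integral zero and converge dominatedly.\<close>

lemma P1_space_Poincare:
  fixes v :: "'a::euclidean_space \<Rightarrow> real"
  assumes part: "fe_partition \<gamma> \<Omega> \<T>" and v: "v \<in> P1_space \<Omega> \<T>" and \<Omega>: "open \<Omega>"
    and R: "0 \<le> R" "\<And>x. x \<in> \<Omega> \<Longrightarrow> norm x \<le> R"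
  shows "L2_norm \<Omega> v \<le> 2 * R * L2_norm \<Omega> (grad v)"
proof -
  have bdd: "bounded \<Omega>" using R(2) by (auto simp: bounded_iff)
  note cont = continuous_on_P1_space[OF part v \<Omega>]
  note zero = P1_space_eq_0[OF part v \<Omega>]
  note v_L2 = L2_fun_P1_space[OF part v \<Omega> bdd] and grad_L2 = L2_fun_grad_P1_space[OF part v \<Omega> bdd]
  obtain B where B: "0 \<le> B" "\<And>x. \<bar>v x\<bar> \<le> B"
    using bounded_P1_space[OF part v \<Omega> bdd] by metis
  obtain M where M: "M-lipschitz_on UNIV v"
    using lipschitz_P1_space[OF part v \<Omega>] by metis
  have M0: "0 \<le> M" using M by (rule lipschitz_on_nonneg)
  obtain e :: 'a where e: "e \<in> Basis" using nonempty_Basis by blast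
  have e_le: "\<bar>x \<bullet> e\<bar> \<le> norm x" for x using e by (rule Basis_le_norm)
  define w where "w x = (x \<bullet> e) * (v x)\<^sup>2" for x
  \<comment> \<open>A sequence of increments, as dominated convergence requires; being at most 1,
    they keep all difference quotients supported in the ball of radius R + 1.\<close>
  define h where "h k = inverse (real (Suc k))" for k
  have h: "0 < h k" "h k \<le> 1" for k by (auto simp: h_def field_simps)
  define s where "s k x = (w (x + h k *\<^sub>R e) - w x) / h k" for k x
  \<comment> \<open>The derivative of w along e is v^2 + 2 (x \<bullet> e) v (grad v \<bullet> e) =
    v (v - g). The constant 2 R comes from |x \<bullet> e| \<le> R on \<Omega>.\<close>
  define g where "g x = - 2 * (x \<bullet> e) * (grad v x \<bullet> e)" for x
  have g_le: "norm (g x) \<le> (2 * R) * norm (grad v x)" if "x \<in> \<Omega>" for x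
  proof -
    have "\<bar>x \<bullet> e\<bar> * \<bar>grad v x \<bullet> e\<bar> \<le> R * norm (grad v x)"
      using e_le[of x] e_le[of "grad v x"] R(1) R(2)[OF that] by (intro mult_mono) auto
    then show ?thesis by (simp add: g_def abs_mult)
  qed
  have g_L2: "L2_fun \<Omega> g"
  proof (rule L2_fun_bound[OF grad_L2 _ g_le])
    have "(\<lambda>x. indicator \<Omega> x *\<^sub>R grad v x) \<in> borel_measurable lebesgue"
      using grad_L2 by (simp only: L2_fun_def set_borel_measurable_def)
    then have "(\<lambda>x. (indicator \<Omega> x *\<^sub>R grad v x) \<bullet> e) \<in> borel_measurable lebesgue"
      by (intro borel_measurable_inner borel_measurable_const)
    moreover have "(\<lambda>x. - 2 * (x \<bullet> e)) \<in> borel_measurable lebesgue"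
      by (intro measurable_completion) simp
    ultimately have "(\<lambda>x. (- 2 * (x \<bullet> e)) * ((indicator \<Omega> x *\<^sub>R grad v x) \<bullet> e)) \<in> borel_measurable lebesgue"
      by (rule borel_measurable_times[rotated])
    moreover have "(- 2 * (x \<bullet> e)) * ((indicator \<Omega> x *\<^sub>R grad v x) \<bullet> e) = indicator \<Omega> x *\<^sub>R g x" for x
      by (simp add: g_def)
    ultimately show "set_borel_measurable lebesgue \<Omega> g"
      by (simp only: set_borel_measurable_def)
  qed
  have w_cont: "continuous_on UNIV w"
    unfolding w_def using cont by (intro continuous_intros)
  then have w_meas: "w \<in> borel_measurable borel" by (rule borel_measurable_continuous_onI)
  have w_shift_meas: "(\<lambda>x. w (x + c)) \<in> borel_measurable borel" for c
    using w_meas by (rule measurable_compose[rotated]) simp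
  have s_meas: "s k \<in> borel_measurable lborel" for k
    unfolding s_def[abs_def] using w_meas w_shift_meas by simp
  have w_int: "integrable lborel w"
  proof -
    have "integrable lborel (\<lambda>x. indicator (cball 0 R) x *\<^sub>R w x)"
      using w_cont by (intro borel_integrable_compact) (auto intro: continuous_on_subset)
    moreover have "(\<lambda>x. indicator (cball 0 R) x *\<^sub>R w x) = w"
    proof
      show "indicator (cball 0 R) x *\<^sub>R w x = w x" for x
        using R(2)[of x] zero[of x] by (cases "x \<in> \<Omega>") (auto simp: w_def indicator_def)
    qed
    ultimately show ?thesis by (simp only:)
  qed
  have s_int: "(\<integral>x. s k x \<partial>lebesgue) = 0" for k
  proof -
    have "(\<integral>x. s k x \<partial>lebesgue) = (\<integral>x. s k x \<partial>lborel)"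
      using s_meas by (rule integral_completion)
    also have "\<dots> = ((\<integral>x. w (x + h k *\<^sub>R e) \<partial>lborel) - (\<integral>x. w x \<partial>lborel)) / h k"
      unfolding s_def using w_int lborel_integrable_translate[OF w_int] by simp
    also have "\<dots> = 0" by (simp add: lborel_integral_translate[OF w_meas])
    finally show ?thesis .
  qed
  have s_le: "norm (s k x) \<le> (B\<^sup>2 + (R + 1) * (2 * B * M)) * indicator (cball 0 (R + 1)) x" for k x
  proof (cases "norm x \<le> R + 1")
    case True
    define y where "y = x + h k *\<^sub>R e"
    \<comment> \<open>Discrete product rule: the bound B controls the change of x \<bullet> e, and
      the Lipschitz constant M the change of v^2, both proportionally to \<open>h k\<close>.\<close>
    have "\<bar>w y - w x\<bar> = \<bar>h k * (v y)\<^sup>2 + (x \<bullet> e) * ((v y + v x) * (v y - v x))\<bar>"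
      using e by (simp add: w_def y_def inner_add_left inner_same_Basis power2_eq_square algebra_simps)
    also have "\<dots> \<le> \<bar>h k * (v y)\<^sup>2\<bar> + \<bar>(x \<bullet> e) * ((v y + v x) * (v y - v x))\<bar>"
      by (rule abs_triangle_ineq)
    also have "\<dots> = h k * \<bar>v y\<bar>\<^sup>2 + \<bar>x \<bullet> e\<bar> * (\<bar>v y + v x\<bar> * \<bar>v y - v x\<bar>)"
      using h(1)[of k] by (simp add: abs_mult)
    also have "\<dots> \<le> h k * B\<^sup>2 + (R + 1) * ((2 * B) * (M * h k))"
    proof (intro add_mono[OF mult_left_mono mult_mono[OF _ mult_mono]])
      show "\<bar>v y\<bar>\<^sup>2 \<le> B\<^sup>2" using B by (intro power_mono) auto
      show "\<bar>x \<bullet> e\<bar> \<le> R + 1" using e_le[of x] True by linarith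
      show "\<bar>v y + v x\<bar> \<le> 2 * B" using B(2)[of x] B(2)[of y] by linarith
      show "\<bar>v y - v x\<bar> \<le> M * h k"
        using lipschitz_onD[OF M, of y x] e h(1)[of k]
        by (simp add: y_def dist_norm)
      show "0 \<le> h k" using h(1)[of k] by (rule less_imp_le)
      show "0 \<le> R + 1" "0 \<le> 2 * B" using B(1) R(1) by linarith+
      show "0 \<le> \<bar>v y - v x\<bar>" by (rule abs_ge_zero)
      show "0 \<le> \<bar>v y + v x\<bar> * \<bar>v y - v x\<bar>" by (intro mult_nonneg_nonneg abs_ge_zero)
    qed
    also have "\<dots> = (B\<^sup>2 + (R + 1) * (2 * B * M)) * h k"
      by (simp add: distrib_right distrib_left mult_ac)
    finally have "\<bar>w y - w x\<bar> / h k \<le> B\<^sup>2 + (R + 1) * (2 * B * M)"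
      using h(1)[of k] by (simp only: pos_divide_le_eq)
    then show ?thesis
      using True h(1)[of k] by (simp add: s_def y_def)
  next
    case False
    have "norm x \<le> norm (x + h k *\<^sub>R e) + norm (h k *\<^sub>R e)"
      by (metis add_diff_cancel_right' norm_triangle_ineq4)
    then have "R < norm (x + h k *\<^sub>R e)" using False h[of k] e by simp
    then have out: "x \<notin> \<Omega>" "x + h k *\<^sub>R e \<notin> \<Omega>" using R(2) False by force+
    have "v x = 0" "v (x + h k *\<^sub>R e) = 0" by (rule zero[OF out(1)], rule zero[OF out(2)])
    then have "s k x = 0" by (simp add: s_def w_def)
    then show ?thesis using False by simp
  qed
  define F where "F x = indicator \<Omega> x *\<^sub>R (v x \<bullet> v x - v x \<bullet> g x)" for x
  have F_int: "set_integrable lebesgue \<Omega> (\<lambda>x. v x \<bullet> v x - v x \<bullet> g x)"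
    by (intro set_integral_diff L2_fun_integrable v_L2 g_L2)
  have "(\<lambda>k. \<integral>x. s k x \<partial>lebesgue) \<longlonglongrightarrow> (\<integral>x. F x \<partial>lebesgue)"
  proof (rule integral_dominated_convergence)
    show "F \<in> borel_measurable lebesgue"
      using F_int unfolding F_def[abs_def] set_integrable_def by (rule borel_measurable_integrable)
    show "s k \<in> borel_measurable lebesgue" for k
      using s_meas by (rule measurable_completion)
    show "integrable lebesgue (\<lambda>x::'a. (B\<^sup>2 + (R + 1) * (2 * B * M)) * indicator (cball 0 (R + 1)) x)"
      using lmeasurable_cball[of "0::'a" "R + 1"]
      by (intro integrable_mult_right integrable_real_indicator) (auto simp: fmeasurable_def)
    show "AE x in lebesgue. norm (s k x) \<le> (B\<^sup>2 + (R + 1) * (2 * B * M)) * indicator (cball 0 (R + 1)) x" for k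
      using s_le by (intro AE_I2)
    show "AE x in lebesgue. (\<lambda>k. s k x) \<longlonglongrightarrow> F x"
      using AE_mesh_regular[OF part]
    proof eventually_elim
      case (elim x)
      have "(v has_derivative (\<lambda>y. y \<bullet> grad v x)) (at x)"
        using P1_space_GDERIV_grad[OF part v elim] by (simp only: gderiv_def)
      then have "(w has_derivative (\<lambda>y. (x \<bullet> e) * (2 * v x * (y \<bullet> grad v x)) + (y \<bullet> e) * (v x)\<^sup>2)) (at x)"
        unfolding w_def[abs_def] power2_eq_square
        by (auto intro!: derivative_eq_intros simp: algebra_simps)
      from has_derivative_difference_quotient[OF this, of e]
      have lim: "(\<lambda>k. s k x) \<longlonglongrightarrow> (x \<bullet> e) * (2 * v x * (e \<bullet> grad v x)) + (e \<bullet> e) * (v x)\<^sup>2"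
        by (simp only: s_def h_def)
      have eq: "(x \<bullet> e) * (2 * v x * (e \<bullet> grad v x)) + (e \<bullet> e) * (v x)\<^sup>2 = F x"
      proof (cases "x \<in> \<Omega>")
        case True
        then show ?thesis
          using e by (simp add: F_def g_def inner_same_Basis power2_eq_square inner_commute[of e "grad v x"])
      next
        \<comment> \<open>Both terms of the derivative contain the factor v x, which is 0
          here.\<close>
        case False
        then show ?thesis using zero[of x] by (simp add: F_def)
      qed
      show ?case using lim unfolding eq .
    qed
  qed
  then have "(\<integral>x. F x \<partial>lebesgue) = 0"
    unfolding s_int by (rule LIMSEQ_unique[OF _ tendsto_const])
  then have "(LINT x:\<Omega>|lebesgue. v x \<bullet> v x - v x \<bullet> g x) = 0"
    by (simp only: F_def set_lebesgue_integral_def)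
  then have "L2_inner \<Omega> v v = L2_inner \<Omega> v g"
    unfolding L2_inner_def using L2_fun_integrable[OF v_L2 v_L2] L2_fun_integrable[OF v_L2 g_L2]
    by (subst (asm) set_integral_diff(2)) auto
  then have "L2_norm \<Omega> v * L2_norm \<Omega> v \<le> L2_norm \<Omega> v * L2_norm \<Omega> g"
    using L2_Cauchy_Schwarz[OF v_L2 g_L2] by (simp only: L2_norm_square[symmetric] power2_eq_square)
  then have "L2_norm \<Omega> v \<le> L2_norm \<Omega> g"
    using L2_norm_nonneg[of \<Omega> v] L2_norm_nonneg[of \<Omega> g] by (cases "L2_norm \<Omega> v = 0") auto
  also have "\<dots> \<le> 2 * R * L2_norm \<Omega> (grad v)"
    using R(1) by (intro L2_norm_bound[OF grad_L2 g_L2 _ g_le]) auto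
  finally show ?thesis .
qed

section \<open>Stability\<close>

lemma fully_discrete_solution_P1_space:
  assumes "fully_discrete_solution \<Omega> \<T> a f \<alpha> T r N uh0 U" "uh0 \<in> P1_space \<Omega> \<T>" "j \<le> N"
  shows "U j \<in> P1_space \<Omega> \<T>"
  using assms by (cases "j = 0") (auto simp: fully_discrete_solution_def)

lemma fully_discrete_solution_test:
  assumes "fully_discrete_solution \<Omega> \<T> a f \<alpha> T r N uh0 U" "n \<in> {1..N}" "v \<in> P1_space \<Omega> \<T>"
  shows "L2_inner \<Omega> (\<lambda>x. \<Sum>j\<le>n. L1_coeff \<alpha> T r N n j * U j x) v
    + a (LINT x:\<Omega>|lebesgue. U n x) * L2_inner \<Omega> (grad (U n)) (grad v)
    = L2_inner \<Omega> (\<lambda>x. f (U n x)) v"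
proof -
  have "L1_deriv \<alpha> T r N U n = (\<lambda>x. \<Sum>j\<le>n. L1_coeff \<alpha> T r N n j * U j x)"
    using assms(2) by (intro ext L1_deriv_eq_sum) simp
  then show ?thesis
    using assms by (simp only: fully_discrete_solution_def) metis
qed

text \<open>With test function \<open>U n\<close> the diffusion term is nonnegative and is dropped;
  then one power of the norm is divided out.\<close>

lemma fully_discrete_solution_L2_step:
  assumes \<alpha>: "0 < \<alpha>" "\<alpha> < 1" and T: "0 < T" and r: "1 \<le> r" and n: "n \<in> {1..N}"
    and \<Omega>: "open \<Omega>" "bounded \<Omega>" and part: "fe_partition \<gamma> \<Omega> \<T>"
    and a: "\<And>y. 0 \<le> a y" and f: "K-lipschitz_on UNIV f" and uh0: "uh0 \<in> P1_space \<Omega> \<T>"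
    and sol: "fully_discrete_solution \<Omega> \<T> a f \<alpha> T r N uh0 U"
  shows "(\<Sum>j\<le>n. L1_coeff \<alpha> T r N n j * L2_norm \<Omega> (U j))
    \<le> K * L2_norm \<Omega> (U n) + \<bar>f 0\<bar> * sqrt (measure lebesgue \<Omega>)"
proof -
  let ?c = "L1_coeff \<alpha> T r N n"
  define S where "S = (\<Sum>j\<le>n. ?c j * L2_norm \<Omega> (U j))"
  define y where "y = L2_norm \<Omega> (U n)"
  define F where "F = \<bar>f 0\<bar> * sqrt (measure lebesgue \<Omega>)"
  have P1: "U j \<in> P1_space \<Omega> \<T>" if "j \<le> n" for j
    using fully_discrete_solution_P1_space[OF sol uh0, of j] that n by simp
  have L2: "L2_fun \<Omega> (U j)" if "j \<le> n" for j
    using L2_fun_P1_space[OF part P1[OF that] \<Omega>] .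
  have c: "?c j \<le> 0" if "j < n" for j
    using L1_coeff_nonpos[of \<alpha> T r N j n] \<alpha> T r n that by simp
  have "y * S \<le> L2_inner \<Omega> (\<lambda>x. \<Sum>j\<le>n. ?c j * U j x) (U n)"
    using L2_inner_sum_ge[of n \<Omega> U ?c] L2 c unfolding y_def S_def real_scaleR_def by blast
  moreover have "0 \<le> a (LINT x:\<Omega>|lebesgue. U n x) * L2_inner \<Omega> (grad (U n)) (grad (U n))"
    using a L2_inner_self_nonneg by (rule mult_nonneg_nonneg)
  moreover have "L2_inner \<Omega> (\<lambda>x. f (U n x)) (U n) \<le> (K * y + F) * y"
    unfolding y_def F_def using \<Omega> f L2[OF order_refl]
    by (intro L2_inner_lipschitz_le lmeasurable_open)
  ultimately have le: "y * S \<le> y * (K * y + F)"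
    using fully_discrete_solution_test[OF sol n P1[OF order_refl]] by (simp add: mult.commute)
  have F: "0 \<le> F" by (simp add: F_def)
  have "S \<le> K * y + F"
  proof (cases "y = 0")
    \<comment> \<open>Division is impossible, but the diagonal term vanishes and the history sum is
      nonpositive.\<close>
    case True
    have "S = (\<Sum>j<n. ?c j * L2_norm \<Omega> (U j)) + ?c n * y"
      unfolding S_def y_def by (simp only: lessThan_Suc_atMost[symmetric] sum.lessThan_Suc)
    moreover have "(\<Sum>j<n. ?c j * L2_norm \<Omega> (U j)) \<le> 0"
      using c L2_norm_nonneg by (intro sum_nonpos mult_nonpos_nonneg) auto
    ultimately show ?thesis using True F by simp
  next
    case False
    then have "0 < y" using L2_norm_nonneg[of \<Omega> "U n"] by (simp add: y_def)
    then show ?thesis using le by simp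
  qed
  then show ?thesis by (simp only: S_def y_def F_def)
qed

text \<open>Testing with the discrete time derivative itself, instead of a discrete Laplacian, suffices
  because the diffusion coefficient is constant in space: dividing by it leaves
  \<open>(grad U\<^sup>n, grad D U\<^sup>n)\<close>.\<close>

lemma fully_discrete_solution_grad_step:
  assumes \<alpha>: "0 < \<alpha>" "\<alpha> < 1" and T: "0 < T" and r: "1 \<le> r" and n: "n \<in> {1..N}"
    and \<Omega>: "open \<Omega>" "bounded \<Omega>" and part: "fe_partition \<gamma> \<Omega> \<T>"
    and a: "0 < m1" "\<And>y. m1 \<le> a y" and f: "K-lipschitz_on UNIV f" and uh0: "uh0 \<in> P1_space \<Omega> \<T>"
    and sol: "fully_discrete_solution \<Omega> \<T> a f \<alpha> T r N uh0 U"
  shows "(\<Sum>j\<le>n. L1_coeff \<alpha> T r N n j * (L2_norm \<Omega> (grad (U j)))\<^sup>2)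
    \<le> (K * L2_norm \<Omega> (U n) + \<bar>f 0\<bar> * sqrt (measure lebesgue \<Omega>))\<^sup>2 / (2 * m1)"
proof -
  let ?c = "L1_coeff \<alpha> T r N n"
  define W where "W = (\<lambda>x. \<Sum>j\<le>n. ?c j * U j x)"
  define S where "S = (\<Sum>j\<le>n. ?c j * (L2_norm \<Omega> (grad (U j)))\<^sup>2)"
  define q where "q = K * L2_norm \<Omega> (U n) + \<bar>f 0\<bar> * sqrt (measure lebesgue \<Omega>)"
  define y where "y = L2_norm \<Omega> W"
  define A where "A = a (LINT x:\<Omega>|lebesgue. U n x)"
  define E where "E = L2_inner \<Omega> (grad (U n)) (grad W)"
  have P1: "U j \<in> P1_space \<Omega> \<T>" if "j \<le> n" for j
    using fully_discrete_solution_P1_space[OF sol uh0, of j] that n by simp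
  have P1_W: "W \<in> P1_space \<Omega> \<T>" unfolding W_def using P1 by (intro P1_space_sum) simp
  have L2: "L2_fun \<Omega> (U n)" "L2_fun \<Omega> W"
    using L2_fun_P1_space[OF part _ \<Omega>] P1[OF order_refl] P1_W by blast+
  have L2_grad: "L2_fun \<Omega> (grad (U j))" if "j \<le> n" for j
    using L2_fun_grad_P1_space[OF part P1[OF that] \<Omega>] .
  have L2_grad_W: "L2_fun \<Omega> (grad W)"
    using L2_fun_grad_P1_space[OF part P1_W \<Omega>] .
  have c: "?c j \<le> 0" if "j < n" for j
    using L1_coeff_nonpos[of \<alpha> T r N j n] \<alpha> T r n that by simp
  \<comment> \<open>Squares are first reduced to a product of norms, then to an inner product of
    gradients; both steps rest on the coefficient signs.\<close>
  have "S / 2 \<le> L2_norm \<Omega> (grad (U n)) * (\<Sum>j\<le>n. ?c j * L2_norm \<Omega> (grad (U j)))"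
    unfolding S_def using c n by (intro half_sum_squares_le sum_L1_coeff_eq_0) auto
  also have "\<dots> \<le> L2_inner \<Omega> (\<lambda>x. \<Sum>j\<le>n. ?c j *\<^sub>R grad (U j) x) (grad (U n))"
    by (rule L2_inner_sum_ge[where V = "\<lambda>j. grad (U j)", OF L2_grad c])
  also have "\<dots> = L2_inner \<Omega> (grad W) (grad (U n))"
  proof (rule L2_inner_cong_AE)
    show "AE x in lebesgue. x \<in> \<Omega> \<longrightarrow>
        (\<Sum>j\<le>n. ?c j *\<^sub>R grad (U j) x) \<bullet> grad (U n) x = grad W x \<bullet> grad (U n) x"
      using AE_mesh_regular[OF part]
    proof eventually_elim
      case (elim x)
      have "grad W x = (\<Sum>j\<le>n. ?c j *\<^sub>R grad (U j) x)"
        unfolding W_def using P1 elim by (intro grad_sum_P1_space[OF part]) simp_all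
      then show ?case by simp
    qed
    have "L2_fun \<Omega> (\<lambda>x. \<Sum>j\<le>n. ?c j *\<^sub>R grad (U j) x)"
      using L2_grad by (intro L2_fun_sum) simp
    then show "set_integrable lebesgue \<Omega> (\<lambda>x. (\<Sum>j\<le>n. ?c j *\<^sub>R grad (U j) x) \<bullet> grad (U n) x)"
      using L2_grad[OF order_refl] by (rule L2_fun_integrable)
    show "set_integrable lebesgue \<Omega> (\<lambda>x. grad W x \<bullet> grad (U n) x)"
      using L2_grad_W L2_grad[OF order_refl] by (rule L2_fun_integrable)
  qed
  finally have E: "S / 2 \<le> E" by (simp only: E_def L2_inner_commute)
  have "y\<^sup>2 + A * E = L2_inner \<Omega> (\<lambda>x. f (U n x)) W"
    using fully_discrete_solution_test[OF sol n P1_W]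
    by (simp only: y_def L2_norm_square A_def E_def W_def)
  also have "\<dots> \<le> q * y"
    unfolding q_def y_def using \<Omega> f L2 by (intro L2_inner_lipschitz_le lmeasurable_open)
  \<comment> \<open>Young with constant 1 / 4, so that y^2 cancels against the squared norm of the
    discrete derivative.\<close>
  also have "\<dots> \<le> y\<^sup>2 + q\<^sup>2 / 4"
    using zero_le_power2[of "y - q / 2"] by (simp add: power2_diff power_divide mult.commute)
  finally have "A * E \<le> q\<^sup>2 / 4" by simp
  have A: "m1 \<le> A" "0 < A" using a by (auto simp: A_def intro: less_le_trans)
  \<comment> \<open>The lower bound m1 may replace A only for positive S; otherwise the claim is
    immediate.\<close>
  have "S \<le> q\<^sup>2 / (2 * m1)"
  proof (cases "S \<le> 0")
    case True
    also have "0 \<le> q\<^sup>2 / (2 * m1)" using a(1) by simp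
    finally show ?thesis .
  next
    case False
    then have "m1 * (S / 2) \<le> A * (S / 2)" using A by (intro mult_right_mono) auto
    also have "\<dots> \<le> A * E" using E A by (intro mult_left_mono) auto
    also have "\<dots> \<le> q\<^sup>2 / 4" by fact
    finally show ?thesis using a(1) by (simp add: pos_le_divide_eq mult_ac)
  qed
  then show ?thesis by (simp only: S_def q_def)
qed

theorem theorem3p2:
  fixes \<Omega> :: "'a::euclidean_space set"
    and a f :: "real \<Rightarrow> real" and u0 :: "'a \<Rightarrow> real"
    and \<alpha> T r m1 m2 L K \<gamma> :: real
  assumes dim: "DIM('a) = 1 \<or> DIM('a) = 2"
    and domain: "open \<Omega>" "bounded \<Omega>" "smooth_boundary \<Omega>"
    and alpha: "0 < \<alpha>" "\<alpha> < 1"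
    and T: "0 < T"
    and r: "1 \<le> r"
    and a_bounds: "0 < m1" "\<And>x. m1 \<le> a x \<and> a x \<le> m2"
    and a_lipschitz: "0 < L" "L-lipschitz_on UNIV a"
    and f_lipschitz: "0 < K" "K-lipschitz_on UNIV f"
    and u0: "u0 \<in> H10 \<Omega> \<inter> H2 \<Omega>"
    and gamma: "0 < \<gamma>"
  shows "\<exists>C. \<forall>N \<T> uh0 U.
           1 \<le> N \<longrightarrow>
           K * Gamma (2 - \<alpha>) * tstep T r N N powr \<alpha> < 1 \<longrightarrow>
           fe_partition \<gamma> \<Omega> \<T> \<longrightarrow>
           uh0 \<in> P1_space \<Omega> \<T> \<longrightarrow>
           fully_discrete_solution \<Omega> \<T> a f \<alpha> T r N uh0 U \<longrightarrow>
           (\<forall>n\<in>{1..N}.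
              L2_norm \<Omega> (U n) \<le> C * (L2_norm \<Omega> (U 0) + 1) \<and>
              L2_norm \<Omega> (grad (U n)) \<le> C * (L2_norm \<Omega> (grad (U 0)) + 1))"
proof -
  have a: "m1 \<le> a y" "0 \<le> a y" for y using a_bounds(2)[of y] a_bounds(1) by linarith+
  have K: "0 \<le> K" using f_lipschitz(1) by simp
  obtain R where R: "0 \<le> R" "\<And>x. x \<in> \<Omega> \<Longrightarrow> norm x \<le> R"
    using domain(2) unfolding bounded_pos by (metis less_imp_le)
  obtain C1 where C1: "0 \<le> C1" and gronwall: "\<And>N. 1 \<le> N \<Longrightarrow>
      K * Gamma (2 - \<alpha>) * tstep T r N N powr \<alpha> < 1 \<Longrightarrow> L1_gronwall_const \<alpha> T r K N C1"
    using L1_gronwall[OF alpha T r K] by metis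
  define F where "F = \<bar>f 0\<bar> * sqrt (measure lebesgue \<Omega>)"
  \<comment> \<open>Poincare turns the forcing q below into at most A (g 0 + 1); C2 then collects
    both terms of C1 ((g 0)^2 + q^2 / (2 m1)). None of these constants involves N or the
    partition.\<close>
  define A where "A = K * C1 * (2 * R) + K * C1 * F + F"
  define C2 where "C2 = C1 * (1 + A\<^sup>2 / (2 * m1))"
  define C where "C = C1 * (1 + F) + sqrt C2"
  have F: "0 \<le> F" by (simp add: F_def)
  have A: "0 \<le> A" using K C1 R(1) F by (simp add: A_def)
  have C2: "0 \<le> C2" using C1 a_bounds(1) by (simp add: C2_def)
  have "L2_norm \<Omega> (U n) \<le> C * (L2_norm \<Omega> (U 0) + 1) \<and>
      L2_norm \<Omega> (grad (U n)) \<le> C * (L2_norm \<Omega> (grad (U 0)) + 1)"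
    if N: "1 \<le> N" "K * Gamma (2 - \<alpha>) * tstep T r N N powr \<alpha> < 1"
      and part: "fe_partition \<gamma> \<Omega> \<T>" and uh0: "uh0 \<in> P1_space \<Omega> \<T>"
      and sol: "fully_discrete_solution \<Omega> \<T> a f \<alpha> T r N uh0 U" and n: "n \<in> {1..N}"
    for N \<T> uh0 U n
  proof -
    define y where "y j = L2_norm \<Omega> (U j)" for j
    define g where "g j = L2_norm \<Omega> (grad (U j))" for j
    have y0: "0 \<le> y j" and g0: "0 \<le> g j" for j by (simp_all add: y_def g_def L2_norm_nonneg)
    have y_step: "(\<Sum>j\<le>m. L1_coeff \<alpha> T r N m j * y j) \<le> K * y m + F" if "m \<in> {1..N}" for m
      unfolding y_def F_def
      by (rule fully_discrete_solution_L2_step[OF alpha T r that domain(1,2) part a(2) f_lipschitz(2) uh0 sol])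
    have y_le: "y m \<le> C1 * (y 0 + F)" if "m \<le> N" for m
      using gronwall[OF N] y_step y0 F that unfolding L1_gronwall_const_def by simp
    \<comment> \<open>By the first estimate K y m + F is at most q at every level, so the gradient
      recursion has a constant forcing.\<close>
    define q where "q = K * (C1 * (y 0 + F)) + F"
    have g_step: "(\<Sum>j\<le>m. L1_coeff \<alpha> T r N m j * (g j)\<^sup>2) \<le> K * (g m)\<^sup>2 + q\<^sup>2 / (2 * m1)"
      if m: "m \<in> {1..N}" for m
    proof -
      have "(\<Sum>j\<le>m. L1_coeff \<alpha> T r N m j * (g j)\<^sup>2) \<le> (K * y m + F)\<^sup>2 / (2 * m1)"
        unfolding y_def g_def F_def
        by (rule fully_discrete_solution_grad_step[OF alpha T r m domain(1,2) part a_bounds(1) a(1) f_lipschitz(2) uh0 sol])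
      also have "\<dots> \<le> q\<^sup>2 / (2 * m1)"
        using y_le[of m] m y0[of m] K F a_bounds(1) unfolding q_def
        by (intro divide_right_mono power_mono add_mono mult_left_mono add_nonneg_nonneg mult_nonneg_nonneg) auto
      \<comment> \<open>The added term gives the gradient recursion the shape covered by the
        constant C1, with the same K and the same step restriction.\<close>
      also have "\<dots> \<le> K * (g m)\<^sup>2 + q\<^sup>2 / (2 * m1)" using K by simp
      finally show ?thesis .
    qed
    have "(\<lambda>j. (g j)\<^sup>2) n \<le> C1 * ((\<lambda>j. (g j)\<^sup>2) 0 + q\<^sup>2 / (2 * m1))"
      using gronwall[OF N, unfolded L1_gronwall_const_def, rule_format, of "\<lambda>j. (g j)\<^sup>2" "q\<^sup>2 / (2 * m1)" n]
        g_step a_bounds(1) n by simp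
    then have g_le: "(g n)\<^sup>2 \<le> C1 * ((g 0)\<^sup>2 + q\<^sup>2 / (2 * m1))" by simp
    have "U 0 \<in> P1_space \<Omega> \<T>" using fully_discrete_solution_P1_space[OF sol uh0, of 0] by simp
    then have Poincare: "y 0 \<le> 2 * R * g 0"
      unfolding y_def g_def by (rule P1_space_Poincare[OF part _ domain(1) R])
    have "q \<le> A * (g 0 + 1)"
    proof -
      have "q \<le> K * (C1 * (2 * R * g 0 + F)) + F"
        unfolding q_def using Poincare K C1 by (intro add_mono mult_left_mono) auto
      \<comment> \<open>The added nonnegative terms are those missing from the product A (g 0 +
        1).\<close>
      also have "\<dots> \<le> K * (C1 * (2 * R * g 0 + F)) + F + (K * C1 * (2 * R) + (K * C1 * F + F) * g 0)"
        using K C1 R(1) F g0[of 0] by simp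
      also have "\<dots> = A * (g 0 + 1)" by (simp add: A_def algebra_simps)
      finally show ?thesis .
    qed
    moreover have "0 \<le> q" using K C1 F y0[of 0] by (simp add: q_def)
    ultimately have "q\<^sup>2 \<le> A\<^sup>2 * (g 0 + 1)\<^sup>2"
      unfolding power_mult_distrib[symmetric] by (rule power_mono)
    then have "q\<^sup>2 / (2 * m1) \<le> A\<^sup>2 / (2 * m1) * (g 0 + 1)\<^sup>2"
      using a_bounds(1) by (simp add: divide_right_mono)
    moreover have "(g 0)\<^sup>2 \<le> 1 * (g 0 + 1)\<^sup>2" using g0[of 0] by (simp add: power_mono)
    ultimately have "(g 0)\<^sup>2 + q\<^sup>2 / (2 * m1) \<le> (1 + A\<^sup>2 / (2 * m1)) * (g 0 + 1)\<^sup>2"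
      unfolding distrib_right by (rule add_mono[rotated])
    then have "C1 * ((g 0)\<^sup>2 + q\<^sup>2 / (2 * m1)) \<le> C2 * (g 0 + 1)\<^sup>2"
      using C1 unfolding C2_def mult.assoc by (rule mult_left_mono)
    with g_le have "(g n)\<^sup>2 \<le> C2 * (g 0 + 1)\<^sup>2" by (rule order_trans)
    then have "g n \<le> sqrt (C2 * (g 0 + 1)\<^sup>2)" by (rule real_le_rsqrt)
    also have "\<dots> = sqrt C2 * (g 0 + 1)" using g0[of 0] by (simp add: real_sqrt_mult)
    also have "\<dots> \<le> C * (g 0 + 1)"
      unfolding C_def using C1 F g0[of 0] by (intro mult_right_mono) auto
    finally have gn: "g n \<le> C * (g 0 + 1)" .
    have "y n \<le> C1 * (y 0 + F)" using y_le n by simp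
    also have "\<dots> \<le> C1 * ((1 + F) * (y 0 + 1))"
    proof (intro mult_left_mono)
      have "0 \<le> F * y 0" using F y0[of 0] by simp
      then show "y 0 + F \<le> (1 + F) * (y 0 + 1)" by (simp add: algebra_simps)
    qed (rule C1)
    also have "\<dots> \<le> C * (y 0 + 1)"
      unfolding C_def mult.assoc[symmetric] using C2 y0[of 0] by (intro mult_right_mono) auto
    finally have yn: "y n \<le> C * (y 0 + 1)" .
    show ?thesis using yn gn by (simp only: y_def g_def)
  qed
  then show ?thesis by (intro exI[of _ C] allI impI ballI)
qed

end
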